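(* Let $L$ be a finite lattice of width at most two and let $\mathcal{L}=(L_x : x\in L)$ be a family of Tr-lattices indexed by the elements of $L$. Then the lexicographic sum $L\oplus\mathcal{L}$ is a Tr-lattice.
   Context: All matroids and lattices are finite. A flat $X$ of a matroid $M$ is cyclic if $M|X$ has no isthmuses; the cyclic flats ordered by inclusion form a lattice $\mathcal{Z}(M)$. A lattice $L$ is a Tr-lattice if every matroid $M$ with $\mathcal{Z}(M)$ isomorphic to $L$ is transversal. The width of an ordered set is the maximum size of an antichain in it. The lexicographic sum $L\oplus\mathcal{L}$ is the ordered set on $\{(x,a): x\in L,\ a\in L_x\}$ with $(x,a)\le(y,b)$ if and only if either $x<y$ in $L$, or $x=y$ and $a\le b$ in $L_x$. *)

theory Defs
  imports "HOL-Algebra.Lattice"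
begin

section \<open>Ordered sets\<close>

definition order_isomorphic :: "'a gorder \<Rightarrow> 'b gorder \<Rightarrow> bool" where
  "order_isomorphic P Q \<longleftrightarrow>
     (\<exists>f. bij_betw f (carrier P) (carrier Q) \<and>
          (\<forall>x\<in>carrier P. \<forall>y\<in>carrier P. x \<sqsubseteq>\<^bsub>P\<^esub> y \<longleftrightarrow> f x \<sqsubseteq>\<^bsub>Q\<^esub> f y))"

definition antichain :: "'a gorder \<Rightarrow> 'a set \<Rightarrow> bool" where
  "antichain P A \<longleftrightarrow>
     A \<subseteq> carrier P \<and> (\<forall>x\<in>A. \<forall>y\<in>A. x \<noteq> y \<longrightarrow> \<not> x \<sqsubseteq>\<^bsub>P\<^esub> y)"

definition width :: "'a gorder \<Rightarrow> nat" where
  "width P = Max (card ` {A. antichain P A})"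

text \<open>The library's lattices may be empty; the lattices considered here are not.\<close>

definition finite_lattice :: "'a gorder \<Rightarrow> bool" where
  "finite_lattice L \<longleftrightarrow> lattice L \<and> finite (carrier L) \<and> carrier L \<noteq> {}"

definition lex_sum :: "'a gorder \<Rightarrow> ('a \<Rightarrow> 'b gorder) \<Rightarrow> ('a \<times> 'b) gorder" where
  "lex_sum L F =
     \<lparr> carrier = (SIGMA x:carrier L. carrier (F x)),
       eq = (=),
       le = (\<lambda>(x, a) (y, b). x \<sqsubset>\<^bsub>L\<^esub> y \<or> (x = y \<and> a \<sqsubseteq>\<^bsub>F x\<^esub> b)) \<rparr>"

section \<open>Matroids\<close>

locale matroid =
  fixes ground :: "'e set" and indep :: "'e set \<Rightarrow> bool"
  assumes finite_ground: "finite ground"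
    and indep_subset_ground: "indep X \<Longrightarrow> X \<subseteq> ground"
    and indep_empty: "indep {}"
    and indep_mono: "\<lbrakk>indep Y; X \<subseteq> Y\<rbrakk> \<Longrightarrow> indep X"
    and indep_augment:
      "\<lbrakk>indep X; indep Y; card X < card Y\<rbrakk> \<Longrightarrow> \<exists>y\<in>Y - X. indep (insert y X)"

definition rank :: "('e set \<Rightarrow> bool) \<Rightarrow> 'e set \<Rightarrow> nat" where
  "rank I X = Max (card ` {Y. Y \<subseteq> X \<and> I Y})"

definition flat :: "'e set \<Rightarrow> ('e set \<Rightarrow> bool) \<Rightarrow> 'e set \<Rightarrow> bool" where
  "flat E I X \<longleftrightarrow> X \<subseteq> E \<and> (\<forall>e\<in>E - X. rank I X < rank I (insert e X))"

text \<open>\<open>restrict_indep I X\<close> gives the independent sets of the restriction, whose ground set is \<open>X\<close>.\<close>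

definition restrict_indep :: "('e set \<Rightarrow> bool) \<Rightarrow> 'e set \<Rightarrow> 'e set \<Rightarrow> bool" where
  "restrict_indep I X Y \<longleftrightarrow> Y \<subseteq> X \<and> I Y"

definition basis :: "('e set \<Rightarrow> bool) \<Rightarrow> 'e set \<Rightarrow> bool" where
  "basis I B \<longleftrightarrow> I B \<and> (\<forall>Y. I Y \<longrightarrow> B \<subseteq> Y \<longrightarrow> Y = B)"

definition isthmus :: "'e set \<Rightarrow> ('e set \<Rightarrow> bool) \<Rightarrow> 'e \<Rightarrow> bool" where
  "isthmus E I e \<longleftrightarrow> e \<in> E \<and> (\<forall>B. basis I B \<longrightarrow> e \<in> B)"

definition cyclic_flat :: "'e set \<Rightarrow> ('e set \<Rightarrow> bool) \<Rightarrow> 'e set \<Rightarrow> bool" where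
  "cyclic_flat E I X \<longleftrightarrow> flat E I X \<and> \<not> (\<exists>e. isthmus X (restrict_indep I X) e)"

definition cyclic_flats :: "'e set \<Rightarrow> ('e set \<Rightarrow> bool) \<Rightarrow> 'e set gorder" where
  "cyclic_flats E I = \<lparr> carrier = {X. cyclic_flat E I X}, eq = (=), le = (\<subseteq>) \<rparr>"

definition partial_transversal :: "nat \<Rightarrow> (nat \<Rightarrow> 'e set) \<Rightarrow> 'e set \<Rightarrow> bool" where
  "partial_transversal n A T \<longleftrightarrow> (\<exists>\<phi>. inj_on \<phi> T \<and> (\<forall>t\<in>T. \<phi> t < n \<and> t \<in> A (\<phi> t)))"

definition transversal :: "'e set \<Rightarrow> ('e set \<Rightarrow> bool) \<Rightarrow> bool" where
  "transversal E I \<longleftrightarrow>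
     (\<exists>n A. (\<forall>j<n. A j \<subseteq> E) \<and> (\<forall>X. I X \<longleftrightarrow> partial_transversal n A X))"

section \<open>Tr-lattices\<close>

text \<open>
  A definition cannot quantify over types, so the ground sets range over finite sets of natural
  numbers.  Every finite matroid is isomorphic to one of this kind; \<open>Tr_latticeD\<close> below
  derives the property for ground sets of arbitrary type.
\<close>

definition Tr_lattice :: "'a gorder \<Rightarrow> bool" where
  "Tr_lattice L \<longleftrightarrow> finite_lattice L \<and>
     (\<forall>(E :: nat set) I. matroid E I \<longrightarrow> order_isomorphic (cyclic_flats E I) L \<longrightarrow> transversal E I)"

definition image_indep :: "('e \<Rightarrow> 'f) \<Rightarrow> ('e set \<Rightarrow> bool) \<Rightarrow> 'f set \<Rightarrow> bool" where
  "image_indep f I Y \<longleftrightarrow> (\<exists>X. I X \<and> Y = f ` X)"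

context
  fixes f :: "'e \<Rightarrow> 'f" and E :: "'e set"
  assumes inj: "inj_on f E"
begin

lemma image_subset_image_iff:
  "\<lbrakk>X \<subseteq> E; Y \<subseteq> E\<rbrakk> \<Longrightarrow> f ` X \<subseteq> f ` Y \<longleftrightarrow> X \<subseteq> Y"
  using inj_on_image_mem_iff[OF inj] by blast

lemma image_indep_iff:
  assumes "\<forall>X. I X \<longrightarrow> X \<subseteq> E" and "X \<subseteq> E"
  shows "image_indep f I (f ` X) \<longleftrightarrow> I X"
  using assms inj by (metis image_indep_def inj_on_image_eq_iff)

lemma matroid_image:
  assumes "matroid E I"
  shows "matroid (f ` E) (image_indep f I)"
proof -
  interpret matroid E I by fact
  show ?thesis
  proof
    show "finite (f ` E)" using finite_ground by simp
    show "X \<subseteq> f ` E" if "image_indep f I X" for X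
      using that indep_subset_ground by (auto simp: image_indep_def)
    show "image_indep f I {}"
      using indep_empty by (auto simp: image_indep_def)
    show "image_indep f I X" if Y: "image_indep f I Y" and XY: "X \<subseteq> Y" for X Y
    proof -
      obtain Y' where Y': "I Y'" "Y = f ` Y'" using Y by (auto simp: image_indep_def)
      obtain X' where "X' \<subseteq> Y'" "X = f ` X'" using XY Y' by (metis subset_imageE)
      then show ?thesis using Y' indep_mono by (auto simp: image_indep_def)
    qed
    show "\<exists>y\<in>Y - X. image_indep f I (insert y X)"
      if XY: "image_indep f I X" "image_indep f I Y" "card X < card Y" for X Y
    proof -
      obtain X' Y' where *: "I X'" "X = f ` X'" "I Y'" "Y = f ` Y'"
        using XY by (auto simp: image_indep_def)
      then have sub: "X' \<subseteq> E" "Y' \<subseteq> E" using indep_subset_ground by auto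
      then have "card X = card X'" "card Y = card Y'"
        using * inj by (auto intro!: card_image intro: inj_on_subset)
      then obtain y where y: "y \<in> Y' - X'" "I (insert y X')"
        using indep_augment * XY(3) by metis
      then have "f y \<in> Y - X"
        using * sub inj by (auto dest: inj_onD)
      moreover have "image_indep f I (insert (f y) X)"
        unfolding image_indep_def by (rule exI[of _ "insert y X'"]) (use y * in auto)
      ultimately show ?thesis by blast
    qed
  qed
qed

lemma rank_image:
  assumes I: "\<forall>X. I X \<longrightarrow> X \<subseteq> E" and X: "X \<subseteq> E"
  shows "rank (image_indep f I) (f ` X) = rank I X"
proof -
  have "{Y. Y \<subseteq> f ` X \<and> image_indep f I Y} = (`) f ` {Y. Y \<subseteq> X \<and> I Y}"
    using image_indep_iff[OF I] X by (auto simp: subset_image_iff)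
  then have "card ` {Y. Y \<subseteq> f ` X \<and> image_indep f I Y}
      = (\<lambda>Y. card (f ` Y)) ` {Y. Y \<subseteq> X \<and> I Y}"
    by (simp add: image_image)
  also have "\<dots> = card ` {Y. Y \<subseteq> X \<and> I Y}"
    using X inj by (intro image_cong) (auto intro!: card_image intro: inj_on_subset)
  finally show ?thesis by (simp add: rank_def)
qed

lemma flat_image:
  assumes I: "\<forall>X. I X \<longrightarrow> X \<subseteq> E" and X: "X \<subseteq> E"
  shows "flat (f ` E) (image_indep f I) (f ` X) \<longleftrightarrow> flat E I X"
proof -
  have "f ` E - f ` X = f ` (E - X)"
    using inj X by (metis inj_on_image_set_diff order_refl Diff_subset)
  moreover have "rank (image_indep f I) (insert (f e) (f ` X)) = rank I (insert e X)"
    if "e \<in> E" for e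
    using rank_image[OF I, of "insert e X"] that X by simp
  ultimately show ?thesis
    using X by (auto simp: flat_def rank_image[OF I X])
qed

lemma basis_image:
  assumes I: "\<forall>X. I X \<longrightarrow> X \<subseteq> E" and B: "B \<subseteq> E"
  shows "basis (image_indep f I) (f ` B) \<longleftrightarrow> basis I B"
proof -
  have "f ` B \<subseteq> f ` Y \<longleftrightarrow> B \<subseteq> Y" "f ` Y = f ` B \<longleftrightarrow> Y = B" if "I Y" for Y
    using I[rule_format, OF that] B inj by (auto simp: image_subset_image_iff inj_on_image_eq_iff)
  then show ?thesis
    unfolding basis_def image_indep_iff[OF I B]
    by (metis (no_types, lifting) image_indep_def)
qed

lemma isthmus_image:
  assumes I: "\<forall>X. I X \<longrightarrow> X \<subseteq> E" and e: "e \<in> E" and X: "X \<subseteq> E"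
  shows "isthmus (f ` X) (image_indep f I) (f e) \<longleftrightarrow> isthmus X I e"
proof -
  have mem: "f e \<in> f ` B \<longleftrightarrow> e \<in> B" if "B \<subseteq> E" for B
    using inj e that by (rule inj_on_image_mem_iff)
  have "(\<forall>B. basis (image_indep f I) B \<longrightarrow> f e \<in> B) \<longleftrightarrow> (\<forall>B. basis I B \<longrightarrow> e \<in> B)"
  proof safe
    fix B assume *: "\<forall>B. basis (image_indep f I) B \<longrightarrow> f e \<in> B" "basis I B"
    then have "B \<subseteq> E" using I by (auto simp: basis_def)
    then show "e \<in> B" using * basis_image[OF I] mem by blast
  next
    fix B assume *: "\<forall>B. basis I B \<longrightarrow> e \<in> B" "basis (image_indep f I) B"
    then obtain B' where B': "I B'" "B = f ` B'"
      by (auto simp: basis_def image_indep_def)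
    then show "f e \<in> B" using * basis_image[OF I] mem I by blast
  qed
  then show ?thesis using mem[OF X] by (simp add: isthmus_def)
qed

lemma restrict_indep_image:
  assumes I: "\<forall>X. I X \<longrightarrow> X \<subseteq> E" and X: "X \<subseteq> E"
  shows "restrict_indep (image_indep f I) (f ` X) = image_indep f (restrict_indep I X)"
proof
  fix Y
  have "f ` Z \<subseteq> f ` X \<longleftrightarrow> Z \<subseteq> X" if "I Z" for Z
    using I[rule_format, OF that] X inj by (simp add: image_subset_image_iff)
  then show "restrict_indep (image_indep f I) (f ` X) Y = image_indep f (restrict_indep I X) Y"
    by (auto simp: restrict_indep_def image_indep_def)
qed

lemma cyclic_flat_image:
  assumes I: "\<forall>X. I X \<longrightarrow> X \<subseteq> E" and X: "X \<subseteq> E"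
  shows "cyclic_flat (f ` E) (image_indep f I) (f ` X) \<longleftrightarrow> cyclic_flat E I X"
proof -
  have R: "\<forall>Y. restrict_indep I X Y \<longrightarrow> Y \<subseteq> E"
    using X by (auto simp: restrict_indep_def)
  have "(\<exists>e. isthmus (f ` X) (image_indep f (restrict_indep I X)) e)
      \<longleftrightarrow> (\<exists>e\<in>X. isthmus (f ` X) (image_indep f (restrict_indep I X)) (f e))"
    by (auto simp: isthmus_def)
  also have "\<dots> \<longleftrightarrow> (\<exists>e\<in>X. isthmus X (restrict_indep I X) e)"
    using isthmus_image[OF R _ X] X by blast
  also have "\<dots> \<longleftrightarrow> (\<exists>e. isthmus X (restrict_indep I X) e)"
    by (auto simp: isthmus_def)
  finally show ?thesis
    by (simp add: cyclic_flat_def flat_image[OF I X] restrict_indep_image[OF I X])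
qed

lemma cyclic_flats_image:
  assumes I: "\<forall>X. I X \<longrightarrow> X \<subseteq> E"
  shows "order_isomorphic (cyclic_flats (f ` E) (image_indep f I)) (cyclic_flats E I)"
proof -
  have sub: "X \<subseteq> E" if "cyclic_flat E I X" for X
    using that by (simp add: cyclic_flat_def flat_def)
  have "Y \<in> (`) f ` {X. cyclic_flat E I X}" if "cyclic_flat (f ` E) (image_indep f I) Y" for Y
  proof -
    have "Y \<subseteq> f ` E" using that by (simp add: cyclic_flat_def flat_def)
    then obtain X where "X \<subseteq> E" "Y = f ` X" by (metis subset_imageE)
    then show ?thesis using that cyclic_flat_image[OF I] by blast
  qed
  then have "(`) f ` {X. cyclic_flat E I X} = {Y. cyclic_flat (f ` E) (image_indep f I) Y}"
    using cyclic_flat_image[OF I] sub by blast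
  moreover have "inj_on ((`) f) {X. cyclic_flat E I X}"
    using inj sub by (auto simp: inj_on_image_eq_iff intro!: inj_onI)
  ultimately have bij: "bij_betw ((`) f) {X. cyclic_flat E I X}
      {Y. cyclic_flat (f ` E) (image_indep f I) Y}"
    by (simp add: bij_betw_def)
  let ?g = "the_inv_into {X. cyclic_flat E I X} ((`) f)"
  have le: "Y \<subseteq> Z \<longleftrightarrow> ?g Y \<subseteq> ?g Z"
    if YZ: "cyclic_flat (f ` E) (image_indep f I) Y" "cyclic_flat (f ` E) (image_indep f I) Z" for Y Z
  proof -
    have "f ` ?g Y = Y" "f ` ?g Z = Z"
      using f_the_inv_into_f_bij_betw[OF bij] YZ by auto
    moreover have "?g Y \<subseteq> E" "?g Z \<subseteq> E"
      using bij_betw_the_inv_into[OF bij] YZ sub by (auto dest!: bij_betwE)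
    ultimately show ?thesis
      using inj by (metis image_subset_image_iff)
  qed
  show ?thesis
    unfolding order_isomorphic_def cyclic_flats_def
    by (rule exI[of _ ?g]) (use le bij_betw_the_inv_into[OF bij] in simp)
qed

lemma transversal_image:
  assumes I: "\<forall>X. I X \<longrightarrow> X \<subseteq> E" and "transversal (f ` E) (image_indep f I)"
  shows "transversal E I"
proof -
  obtain n A where A: "\<And>j. j < n \<Longrightarrow> A j \<subseteq> f ` E"
    and iff: "\<And>X. image_indep f I X \<longleftrightarrow> partial_transversal n A X"
    using assms(2) by (auto simp: transversal_def)
  define A' where "A' j = {e \<in> E. f e \<in> A j}" for j
  have "I X \<longleftrightarrow> partial_transversal n A' X" for X
  proof (cases "X \<subseteq> E")
    case True
    then have injX: "inj_on f X" using inj inj_on_subset by blast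
    have "I X \<longleftrightarrow> partial_transversal n A (f ` X)"
      using image_indep_iff[OF I True] iff by simp
    also have "\<dots> \<longleftrightarrow> partial_transversal n A' X"
    proof
      assume "partial_transversal n A (f ` X)"
      then obtain \<phi> where "inj_on \<phi> (f ` X)" "\<forall>t\<in>f ` X. \<phi> t < n \<and> t \<in> A (\<phi> t)"
        by (auto simp: partial_transversal_def)
      then have "inj_on (\<phi> \<circ> f) X \<and> (\<forall>t\<in>X. (\<phi> \<circ> f) t < n \<and> t \<in> A' ((\<phi> \<circ> f) t))"
        using True injX by (auto simp: A'_def comp_inj_on)
      then show "partial_transversal n A' X"
        unfolding partial_transversal_def by blast
    next
      assume "partial_transversal n A' X"
      then obtain \<phi> where \<phi>: "inj_on \<phi> X" "\<forall>t\<in>X. \<phi> t < n \<and> t \<in> A' (\<phi> t)"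
        by (auto simp: partial_transversal_def)
      let ?\<psi> = "\<phi> \<circ> the_inv_into X f"
      have "inj_on ?\<psi> (f ` X)"
        using \<phi>(1) injX
        by (intro comp_inj_on) (auto simp: inj_on_the_inv_into the_inv_into_onto)
      moreover have "\<forall>t\<in>f ` X. ?\<psi> t < n \<and> t \<in> A (?\<psi> t)"
        using \<phi>(2) injX by (auto simp: the_inv_into_f_f A'_def)
      ultimately show "partial_transversal n A (f ` X)"
        unfolding partial_transversal_def by blast
    qed
    finally show ?thesis .
  next
    case False
    then show ?thesis using I by (auto simp: partial_transversal_def A'_def)
  qed
  then show ?thesis
    unfolding transversal_def by (intro exI[of _ n] exI[of _ A']) (auto simp: A'_def)
qed

end

lemma order_isomorphic_trans:
  assumes "order_isomorphic P Q" and "order_isomorphic Q R"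
  shows "order_isomorphic P R"
proof -
  obtain f where f: "bij_betw f (carrier P) (carrier Q)"
      "\<forall>x\<in>carrier P. \<forall>y\<in>carrier P. x \<sqsubseteq>\<^bsub>P\<^esub> y \<longleftrightarrow> f x \<sqsubseteq>\<^bsub>Q\<^esub> f y"
    using assms(1) by (auto simp: order_isomorphic_def)
  obtain g where g: "bij_betw g (carrier Q) (carrier R)"
      "\<forall>x\<in>carrier Q. \<forall>y\<in>carrier Q. x \<sqsubseteq>\<^bsub>Q\<^esub> y \<longleftrightarrow> g x \<sqsubseteq>\<^bsub>R\<^esub> g y"
    using assms(2) by (auto simp: order_isomorphic_def)
  have "bij_betw (g \<circ> f) (carrier P) (carrier R)"
    using f(1) g(1) by (rule bij_betw_trans)
  moreover have "\<forall>x\<in>carrier P. f x \<in> carrier Q"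
    using f(1) bij_betwE by blast
  ultimately show ?thesis
    unfolding order_isomorphic_def using f(2) g(2) by (intro exI[of _ "g \<circ> f"]) auto
qed

theorem Tr_latticeD:
  fixes E :: "'e set"
  assumes "Tr_lattice L" and "matroid E I" and "order_isomorphic (cyclic_flats E I) L"
  shows "transversal E I"
proof -
  interpret matroid E I by fact
  have sub: "\<forall>X. I X \<longrightarrow> X \<subseteq> E" using indep_subset_ground by blast
  obtain f :: "'e \<Rightarrow> nat" where inj: "inj_on f E"
    using finite_ground finite_imp_inj_to_nat_seg by blast
  have "order_isomorphic (cyclic_flats (f ` E) (image_indep f I)) L"
    using cyclic_flats_image[OF inj sub] assms(3)
    by (rule order_isomorphic_trans)
  then have "transversal (f ` E) (image_indep f I)"
    using assms(1) matroid_image[OF inj assms(2)] by (auto simp: Tr_lattice_def)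
  then show ?thesis
    using transversal_image[OF inj sub] by blast
qed

end

theory Submission
  imports Defs
begin

text \<open>
  Let \<open>Z\<close> be the lattice of cyclic flats of a matroid with rank function \<open>r\<close>, and let \<open>\<gamma>\<close> be the
  integer weights on \<open>Z\<close> for which the elements above any \<open>X\<close> have total weight \<open>N - r X\<close>.  By the
  Mason--Ingleton theorem, in a form free of inclusion--exclusion, the matroid is transversal iff
  every nonempty up-set \<open>U\<close> of \<open>Z\<close> has weight at most \<open>N - r (\<Inter>U)\<close>: for a presentation \<open>A\<close>, the
  weight of \<open>Y\<close> counts the sets \<open>A j\<close> for which \<open>Y\<close> is the largest cyclic flat disjoint from \<open>A j\<close>;
  conversely, taking \<open>\<gamma> Y\<close> copies of the complement of each \<open>Y\<close> gives a presentation by Hall's theorem.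

  If \<open>Z\<close> is a lexicographic sum over \<open>L\<close>, the fibre over \<open>x\<close> is the lattice of cyclic flats of a minor,
  so the inequality holds within each fibre, and hence for the up-sets generated by a part of one
  fibre.  As \<open>L\<close> has width at most two, any other up-set is generated by parts of the fibres over two
  incomparable elements \<open>x\<close> and \<open>y\<close>.  The two up-sets so generated meet in the principal up-set of the
  least element over the join of \<open>x\<close> and \<open>y\<close>, and the inequality follows from submodularity of \<open>r\<close>.
\<close>

subsection \<open>Rank and cyclic flats\<close>

context matroid
begin

lemma finite_indep_subsets: "finite {Y. Y \<subseteq> X \<and> indep Y}"
  by (rule finite_subset[of _ "Pow ground"]) (use indep_subset_ground finite_ground in auto)

lemma indep_finite: "indep X \<Longrightarrow> finite X"
  using indep_subset_ground finite_ground finite_subset by blast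

lemma card_le_rank: "\<lbrakk>indep Y; Y \<subseteq> X\<rbrakk> \<Longrightarrow> card Y \<le> rank indep X"
  unfolding rank_def using finite_indep_subsets by (intro Max_ge) auto

lemma obtain_rank:
  obtains B where "indep B" "B \<subseteq> X" "card B = rank indep X"
proof -
  have "rank indep X \<in> card ` {Y. Y \<subseteq> X \<and> indep Y}"
    unfolding rank_def using finite_indep_subsets indep_empty by (intro Max_in) auto
  then show ?thesis using that by auto
qed

lemma extend_indep:
  assumes "indep Y" "Y \<subseteq> X"
  obtains B where "Y \<subseteq> B" "B \<subseteq> X" "indep B" "card B = rank indep X"
proof -
  obtain B where B: "B \<in> {B. B \<subseteq> X \<and> indep B}" "Y \<subseteq> B"
      "\<forall>C\<in>{B. B \<subseteq> X \<and> indep B}. B \<subseteq> C \<longrightarrow> B = C"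
    using finite_has_maximal2[OF finite_indep_subsets, of Y X] assms by auto
  obtain C where C: "indep C" "C \<subseteq> X" "card C = rank indep X"
    by (rule obtain_rank)
  have "card B = rank indep X"
  proof (rule ccontr)
    assume "card B \<noteq> rank indep X"
    then have "card B < card C" using B C card_le_rank by (metis (mono_tags) le_neq_implies_less mem_Collect_eq)
    then obtain c where "c \<in> C - B" "indep (insert c B)"
      using indep_augment B(1) C(1) by blast
    then show False using B(1,3) C(2) by blast
  qed
  with B that show ?thesis by auto
qed

lemma rank_mono: "X \<subseteq> Y \<Longrightarrow> rank indep X \<le> rank indep Y"
  by (metis obtain_rank card_le_rank order_trans)

lemma rank_le_card: "finite X \<Longrightarrow> rank indep X \<le> card X"
  by (metis obtain_rank card_mono)

lemma indep_iff_rank: "finite X \<Longrightarrow> indep X \<longleftrightarrow> rank indep X = card X"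
  by (metis obtain_rank card_le_rank card_subset_eq order_refl rank_le_card order_antisym)

text \<open>A basis \<open>B\<close> of the intersection extends to a basis \<open>C\<close> of the
  union. The traces of \<open>C\<close> on \<open>X\<close> and \<open>Y\<close> are independent,
  they cover \<open>C\<close>, and they share at least \<open>B\<close>.\<close>

lemma rank_submodular:
  "rank indep (X \<union> Y) + rank indep (X \<inter> Y) \<le> rank indep X + rank indep Y"
proof -
  obtain B where B: "indep B" "B \<subseteq> X \<inter> Y" "card B = rank indep (X \<inter> Y)"
    by (rule obtain_rank)
  obtain C where C: "B \<subseteq> C" "C \<subseteq> X \<union> Y" "indep C" "card C = rank indep (X \<union> Y)"
    using extend_indep[of B "X \<union> Y"] B by blast
  have fin: "finite C" using C(3) by (rule indep_finite)
  have "card (C \<inter> X) + card (C \<inter> Y) = card (C \<inter> X \<union> C \<inter> Y) + card (C \<inter> X \<inter> (C \<inter> Y))"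
    using fin by (intro card_Un_Int) auto
  moreover have "card (C \<inter> X \<union> C \<inter> Y) = card C"
    using C by (intro arg_cong[where f = card]) auto
  moreover have "card B \<le> card (C \<inter> X \<inter> (C \<inter> Y))"
    using fin B C by (intro card_mono) auto
  moreover have "card (C \<inter> X) \<le> rank indep X" "card (C \<inter> Y) \<le> rank indep Y"
    using C(3) by (auto intro!: card_le_rank intro: indep_mono)
  ultimately show ?thesis using B(3) C(4) by linarith
qed

lemma rank_Un_le: "finite Y \<Longrightarrow> rank indep (X \<union> Y) \<le> rank indep X + card Y"
  using rank_submodular[of X Y] rank_le_card[of Y] by linarith

text \<open>If the rank grew, augmenting a basis of \<open>X\<close> from a basis of
  \<open>X \<union> Y\<close> would give a single element of \<open>Y\<close> that already raises
  the rank of \<open>X\<close>.\<close>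

lemma rank_Un_eq:
  assumes "\<And>y. y \<in> Y \<Longrightarrow> rank indep (insert y X) = rank indep X"
  shows "rank indep (X \<union> Y) = rank indep X"
proof (rule ccontr)
  assume neq: "rank indep (X \<union> Y) \<noteq> rank indep X"
  obtain B where B: "indep B" "B \<subseteq> X" "card B = rank indep X"
    by (rule obtain_rank)
  obtain C where C: "indep C" "C \<subseteq> X \<union> Y" "card C = rank indep (X \<union> Y)"
    by (rule obtain_rank)
  have "card B < card C"
    using neq rank_mono[of X "X \<union> Y"] B C by auto
  then obtain c where c: "c \<in> C - B" "indep (insert c B)"
    using indep_augment B(1) C(1) by blast
  then have "card (insert c B) \<le> rank indep (insert c X)"
    using B by (intro card_le_rank) auto
  then have "rank indep X < rank indep (insert c X)"
    using c B indep_finite by auto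
  then show False
    using assms c C by (cases "c \<in> X") (auto simp: insert_absorb)
qed

text \<open>Monotonicity of closure, phrased by ranks: for \<open>e\<close> outside
  \<open>Y\<close>, the sets \<open>insert e X\<close> and \<open>Y\<close> meet in
  \<open>X\<close>, so submodularity applies.\<close>

lemma rank_insert_eq_mono:
  assumes "rank indep (insert e X) = rank indep X" "X \<subseteq> Y"
  shows "rank indep (insert e Y) = rank indep Y"
proof (cases "e \<in> Y")
  case False
  then have "insert e X \<union> Y = insert e Y" "insert e X \<inter> Y = X" using assms by auto
  then have "rank indep (insert e Y) \<le> rank indep Y"
    using rank_submodular[of "insert e X" Y] assms by simp
  then show ?thesis using rank_mono[OF subset_insertI, of Y e] by simp
qed (simp add: insert_absorb)

section \<open>Closure and flats\<close>

definition closure :: "'e set \<Rightarrow> 'e set" where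
  "closure X = {e \<in> ground. rank indep (insert e X) = rank indep X}"

lemma closure_subset_ground: "closure X \<subseteq> ground"
  by (auto simp: closure_def)

lemma subset_closure: "X \<subseteq> ground \<Longrightarrow> X \<subseteq> closure X"
  by (auto simp: closure_def insert_absorb)

lemma rank_closure:
  assumes "X \<subseteq> ground"
  shows "rank indep (closure X) = rank indep X"
proof -
  have "rank indep (X \<union> closure X) = rank indep X"
    by (rule rank_Un_eq) (auto simp: closure_def)
  then show ?thesis using subset_closure[OF assms] by (simp add: Un_absorb1)
qed

lemma flat_closure:
  assumes X: "X \<subseteq> ground"
  shows "flat ground indep (closure X)"
proof -
  have "rank indep (closure X) < rank indep (insert e (closure X))" if e: "e \<in> ground - closure X" for e
  proof -
    have "rank indep X < rank indep (insert e X)"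
      using e rank_mono[OF subset_insertI, of X e] by (auto simp: closure_def)
    also have "\<dots> \<le> rank indep (insert e (closure X))"
      using subset_closure[OF X] by (intro rank_mono) auto
    finally show ?thesis by (simp add: rank_closure[OF X])
  qed
  then show ?thesis using closure_subset_ground by (auto simp: flat_def)
qed

lemma closure_subset_flat:
  assumes "flat ground indep F" "X \<subseteq> F"
  shows "closure X \<subseteq> F"
proof
  fix e assume e: "e \<in> closure X"
  then have "rank indep (insert e F) = rank indep F"
    using rank_insert_eq_mono assms(2) by (auto simp: closure_def)
  then show "e \<in> F" using assms(1) e by (force simp: flat_def closure_def)
qed

section \<open>Isthmuses, cyclic sets and cyclic flats\<close>

lemma isthmus_restrict_iff:
  "isthmus X (restrict_indep indep X) e \<longleftrightarrow> e \<in> X \<and> rank indep (X - {e}) < rank indep X"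
proof -
  \<comment> \<open>Maximal independent subsets of \<open>X\<close> have cardinality
    \<open>rank indep X\<close>, so some basis avoids an element \<open>e\<close> of
    \<open>X\<close> exactly when deleting \<open>e\<close> keeps the rank.\<close>
  have bas: "basis (restrict_indep indep X) B \<longleftrightarrow> B \<subseteq> X \<and> indep B \<and> card B = rank indep X" for B
  proof
    assume "basis (restrict_indep indep X) B"
    then have B: "B \<subseteq> X" "indep B" "\<And>Y. Y \<subseteq> X \<Longrightarrow> indep Y \<Longrightarrow> B \<subseteq> Y \<Longrightarrow> Y = B"
      by (auto simp: basis_def restrict_indep_def)
    obtain C where C: "B \<subseteq> C" "C \<subseteq> X" "indep C" "card C = rank indep X"
      using extend_indep B(1,2) by blast
    then show "B \<subseteq> X \<and> indep B \<and> card B = rank indep X" using B(3)[of C] B(1,2) by simp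
  next
    assume B: "B \<subseteq> X \<and> indep B \<and> card B = rank indep X"
    have "Y = B" if "Y \<subseteq> X" "indep Y" "B \<subseteq> Y" for Y
      using card_le_rank[of Y X] card_subset_eq[of Y B] card_mono[of Y B] indep_finite[of Y] B that by auto
    then show "basis (restrict_indep indep X) B"
      using B by (auto simp: basis_def restrict_indep_def)
  qed
  show ?thesis
  proof (cases "e \<in> X")
    case True
    obtain C where C: "indep C" "C \<subseteq> X - {e}" "card C = rank indep (X - {e})"
      by (rule obtain_rank)
    have le: "rank indep (X - {e}) \<le> rank indep X" by (rule rank_mono) auto
    have "(\<forall>B. basis (restrict_indep indep X) B \<longrightarrow> e \<in> B) \<longleftrightarrow> rank indep (X - {e}) < rank indep X"
    proof
      assume *: "\<forall>B. basis (restrict_indep indep X) B \<longrightarrow> e \<in> B"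
      show "rank indep (X - {e}) < rank indep X"
      proof (rule ccontr)
        assume "\<not> ?thesis"
        then have "basis (restrict_indep indep X) C" using bas C le by auto
        then show False using * C by auto
      qed
    next
      assume lt: "rank indep (X - {e}) < rank indep X"
      show "\<forall>B. basis (restrict_indep indep X) B \<longrightarrow> e \<in> B"
      proof (intro allI impI, rule ccontr)
        fix B assume "basis (restrict_indep indep X) B" "e \<notin> B"
        then have "card B = rank indep X" "indep B" "B \<subseteq> X - {e}"
          using bas by auto
        then have "card B = rank indep X" "card B \<le> rank indep (X - {e})"
          using card_le_rank[of B "X - {e}"] by auto
        then show False using lt by simp
      qed
    qed
    then show ?thesis using True by (simp add: isthmus_def)
  qed (simp add: isthmus_def)
qed

text \<open>For subsets of the ground set these are the unions of circuits; the rank form makes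
  circuits unnecessary.\<close>

definition cyclic :: "'e set \<Rightarrow> bool" where
  "cyclic X \<longleftrightarrow> (\<forall>e\<in>X. rank indep (X - {e}) = rank indep X)"

lemma cyclic_flat_iff: "cyclic_flat ground indep X \<longleftrightarrow> flat ground indep X \<and> cyclic X"
proof -
  have "rank indep (X - {e}) \<le> rank indep X" for e by (rule rank_mono) auto
  then show ?thesis
    unfolding cyclic_flat_def cyclic_def isthmus_restrict_iff
    by (metis less_irrefl le_neq_implies_less)
qed

text \<open>Since \<open>e\<close> is spanned by \<open>X - {e}\<close>, it is also spanned by the
  larger set \<open>Y - {e}\<close>. This is why unions of cyclic sets are cyclic.\<close>

lemma cyclic_imp_rank_remove:
  assumes "cyclic X" "X \<subseteq> Y" "e \<in> X"
  shows "rank indep (Y - {e}) = rank indep Y"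
proof -
  have "rank indep (insert e (X - {e})) = rank indep (X - {e})"
    using assms by (simp add: cyclic_def insert_absorb)
  then have "rank indep (insert e (Y - {e})) = rank indep (Y - {e})"
    by (rule rank_insert_eq_mono) (use assms in auto)
  then show ?thesis using assms by (simp add: insert_absorb subsetD)
qed

lemma cyclic_Union: "(\<And>X. X \<in> \<X> \<Longrightarrow> cyclic X) \<Longrightarrow> cyclic (\<Union>\<X>)"
  unfolding cyclic_def[of "\<Union>\<X>"] using cyclic_imp_rank_remove by blast

text \<open>Elements of \<open>X\<close> are not isthmuses of the closure because \<open>X\<close>
  is cyclic; deleting any other element leaves a set that contains \<open>X\<close> and so still has
  full rank. Applied to unions, this supplies joins of cyclic flats.\<close>

lemma cyclic_flat_closure:
  assumes "X \<subseteq> ground" "cyclic X"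
  shows "cyclic_flat ground indep (closure X)"
proof -
  have "rank indep (closure X - {e}) = rank indep (closure X)" if "e \<in> closure X" for e
  proof (cases "e \<in> X")
    case True
    then show ?thesis using cyclic_imp_rank_remove assms subset_closure by blast
  next
    case False
    then have "X \<subseteq> closure X - {e}" using subset_closure assms by blast
    then have "rank indep (closure X) \<le> rank indep (closure X - {e})"
      using rank_mono rank_closure assms(1) by metis
    then show ?thesis using rank_mono[OF Diff_subset, of "closure X" "{e}"] by simp
  qed
  then show ?thesis using flat_closure assms by (auto simp: cyclic_flat_iff cyclic_def)
qed

lemma finite_cyclic_flats: "finite {X. cyclic_flat ground indep X}"
  by (rule finite_subset[of _ "Pow ground"]) (auto simp: cyclic_flat_def flat_def finite_ground)

lemma cyclic_flat_closure_empty: "cyclic_flat ground indep (closure {})"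
  by (rule cyclic_flat_closure) (auto simp: cyclic_def)

lemma rank_empty [simp]: "rank indep {} = 0"
  using rank_le_card[of "{}"] by simp

text \<open>The isthmuses can be deleted one at a time: each stays an isthmus of what remains, as an
  element spanned by a smaller set is spanned by the larger one.\<close>

lemma rank_remove_isthmuses:
  assumes fin: "finite S" and S: "S \<subseteq> {e\<in>F. rank indep (F - {e}) < rank indep F}"
  shows "rank indep (F - S) + card S = rank indep F"
  using fin S
proof (induction S rule: finite_induct)
  case (insert e S)
  have lt: "rank indep (F - {e}) < rank indep F" using insert by auto
  have eF: "e \<in> F" using insert by auto
  have "rank indep (F - S - {e}) \<noteq> rank indep (F - S)"
  proof
    assume "rank indep (F - S - {e}) = rank indep (F - S)"
    then have "rank indep (insert e (F - S - {e})) = rank indep (F - S - {e})"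
      using insert eF by (simp add: insert_absorb)
    then have "rank indep (insert e (F - {e})) = rank indep (F - {e})"
      by (rule rank_insert_eq_mono) auto
    then show False using lt eF by (simp add: insert_absorb)
  qed
  moreover have "rank indep (F - S - {e}) \<le> rank indep (F - S)" by (rule rank_mono) auto
  moreover have "rank indep (F - S) \<le> rank indep (F - S - {e}) + 1"
    using rank_Un_le[of "{e}" "F - S - {e}"] eF insert by (simp add: insert_absorb)
  moreover have "F - insert e S = F - S - {e}" by auto
  ultimately show ?case using insert by auto
qed simp

text \<open>The witness is the closure \<open>F\<close> of \<open>X\<close> with its set
  \<open>S\<close> of isthmuses deleted. Each isthmus accounts for one unit of rank, and all
  elements of \<open>X\<close> outside the witness are isthmuses.\<close>

lemma obtain_cyclic_flat_rank:
  assumes X: "X \<subseteq> ground"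
  obtains Z where "cyclic_flat ground indep Z" "rank indep Z + card (X - Z) \<le> rank indep X"
proof -
  define F where "F = closure X"
  have F: "flat ground indep F" "F \<subseteq> ground" "X \<subseteq> F" "rank indep F = rank indep X"
    using X flat_closure closure_subset_ground subset_closure rank_closure by (auto simp: F_def)
  define S where "S = {e\<in>F. rank indep (F - {e}) < rank indep F}"
  have fin: "finite F" using F finite_ground finite_subset by blast
  then have finS: "finite S" by (simp add: S_def)
  have r: "rank indep (F - S) + card S = rank indep F"
    using rank_remove_isthmuses[OF finS] by (simp add: S_def)
  have "rank indep (F - S) < rank indep (insert e (F - S))" if e: "e \<in> ground - (F - S)" for e
  proof (rule ccontr)
    assume "\<not> ?thesis"
    then have eq: "rank indep (insert e (F - S)) = rank indep (F - S)"
      using rank_mono[OF subset_insertI, of "F - S" e] by simp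
    show False
    proof (cases "e \<in> F")
      case True
      then have "e \<in> S" using e by auto
      then have "rank indep (insert e (F - {e})) = rank indep (F - {e})"
        using eq by (intro rank_insert_eq_mono[OF eq]) auto
      then show False using \<open>e \<in> S\<close> by (auto simp: S_def insert_absorb)
    next
      case False
      then show False using rank_insert_eq_mono[OF eq, of F] F(1) e by (force simp: flat_def)
    qed
  qed
  then have "flat ground indep (F - S)" using F by (auto simp: flat_def)
  moreover have "cyclic (F - S)"
    unfolding cyclic_def
  proof
    fix e assume e: "e \<in> F - S"
    \<comment> \<open>Were \<open>e\<close> an isthmus of \<open>F - S\<close>, putting
      \<open>S\<close> back could not restore the full rank of \<open>F\<close>; but
      \<open>F - {e}\<close> has that rank, because \<open>e\<close> is not in
      \<open>S\<close>.\<close>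
    have "rank indep F = rank indep (F - {e})"
      using e rank_mono[OF Diff_subset, of F "{e}"] by (simp add: S_def)
    also have "\<dots> = rank indep ((F - S - {e}) \<union> S)"
      using e by (intro arg_cong[where f = "rank indep"]) (auto simp: S_def)
    also have "\<dots> \<le> rank indep (F - S - {e}) + card S" by (rule rank_Un_le[OF finS])
    finally show "rank indep (F - S - {e}) = rank indep (F - S)"
      using r rank_mono[OF Diff_subset, of "F - S" "{e}"] by simp
  qed
  moreover have "card (X - (F - S)) \<le> card S"
    using F finS by (intro card_mono) auto
  ultimately show ?thesis
    using that[of "F - S"] r F by (auto simp: cyclic_flat_iff)
qed

text \<open>A matroid is determined by its cyclic flats and their ranks. For the converse, the
  inequality is needed only at the cyclic flat that realises the rank of \<open>X\<close>.\<close>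

lemma indep_iff_cyclic_flats:
  assumes X: "X \<subseteq> ground"
  shows "indep X \<longleftrightarrow> (\<forall>Z. cyclic_flat ground indep Z \<longrightarrow> card (X \<inter> Z) \<le> rank indep Z)"
proof
  assume "indep X"
  then show "\<forall>Z. cyclic_flat ground indep Z \<longrightarrow> card (X \<inter> Z) \<le> rank indep Z"
    by (auto intro!: card_le_rank intro: indep_mono)
next
  assume *: "\<forall>Z. cyclic_flat ground indep Z \<longrightarrow> card (X \<inter> Z) \<le> rank indep Z"
  have fin: "finite X" using X finite_ground finite_subset by blast
  obtain Z where Z: "cyclic_flat ground indep Z" "rank indep Z + card (X - Z) \<le> rank indep X"
    using obtain_cyclic_flat_rank[OF X] .
  have "card X = card (X \<inter> Z) + card (X - Z)" using fin by (metis card_Int_Diff)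
  then have "card X \<le> rank indep X" using * Z by force
  then show "indep X" using indep_iff_rank[OF fin] rank_le_card[OF fin] by auto
qed

end

subsection \<open>Hall's theorem\<close>

text \<open>The induction splits on whether some nonempty proper subset has no spare neighbour. If
  so, that subset and its complement are matched separately; if not, any single element may be
  matched first.\<close>

lemma marriage:
  fixes A :: "'i \<Rightarrow> 'e set"
  assumes "finite X" "finite K"
    and "\<And>S. S \<subseteq> X \<Longrightarrow> card S \<le> card {j\<in>K. A j \<inter> S \<noteq> {}}"
  shows "\<exists>\<phi>. inj_on \<phi> X \<and> (\<forall>t\<in>X. \<phi> t \<in> K \<and> t \<in> A (\<phi> t))"
  using assms
proof (induction "card X" arbitrary: X K rule: less_induct)
  case less
  \<comment> \<open>The index set is an argument because the induction also passes to smaller index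
    sets.\<close>
  define J where "J K S = {j\<in>K. A j \<inter> S \<noteq> {}}" for K :: "'i set" and S
  have finJ: "finite (J K S)" for S using less.prems(2) by (simp add: J_def)
  have hall: "card S \<le> card (J K S)" if "S \<subseteq> X" for S
    using less.prems(3)[OF that] by (simp add: J_def)
  have IH: "\<exists>\<phi>. inj_on \<phi> X' \<and> (\<forall>t\<in>X'. \<phi> t \<in> K' \<and> t \<in> A (\<phi> t))"
    if "X' \<subset> X" "K' \<subseteq> K" "\<And>S. S \<subseteq> X' \<Longrightarrow> card S \<le> card (J K' S)" for X' K'
    using less.hyps[of X' K'] that less.prems(1,2) psubset_card_mono[of X X'] finite_subset
    by (metis (no_types, lifting) J_def psubset_imp_subset)
  show ?case
  proof (cases "X = {}")
    case False
    show ?thesis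
    proof (cases "\<exists>S. S \<noteq> {} \<and> S \<subset> X \<and> card (J K S) \<le> card S")
      case True
      then obtain S where S: "S \<noteq> {}" "S \<subset> X" "card (J K S) \<le> card S" by blast
      obtain \<phi> where \<phi>: "inj_on \<phi> S" "\<forall>t\<in>S. \<phi> t \<in> K \<and> t \<in> A (\<phi> t)"
        using IH[of S K] S(2) hall by auto
      \<comment> \<open>Hall's condition survives outside \<open>S\<close>: apply it to
        \<open>R \<union> S\<close> and subtract the neighbours of \<open>S\<close>, of which there
        are at most \<open>card S\<close>.\<close>
      have "card R \<le> card (J (K - J K S) R)" if R: "R \<subseteq> X - S" for R
      proof -
        have fin: "finite R" "finite S" using R S less.prems(1) by (auto intro: finite_subset)
        have "card R + card S = card (R \<union> S)"
          using R fin by (subst card_Un_disjoint) auto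
        also have "\<dots> \<le> card (J K (R \<union> S))" using R S by (intro hall) auto
        also have "\<dots> = card (J (K - J K S) R \<union> J K S)"
          by (intro arg_cong[where f = card]) (auto simp: J_def)
        also have "\<dots> \<le> card (J (K - J K S) R) + card (J K S)" by (rule card_Un_le)
        finally show ?thesis using S(3) by simp
      qed
      then obtain \<psi> where \<psi>: "inj_on \<psi> (X - S)" "\<forall>t\<in>X - S. \<psi> t \<in> K - J K S \<and> t \<in> A (\<psi> t)"
        using IH[of "X - S" "K - J K S"] S by auto
      let ?f = "\<lambda>t. if t \<in> S then \<phi> t else \<psi> t"
      have J: "\<phi> t \<in> J K S" if "t \<in> S" for t
        using \<phi>(2) that by (auto simp: J_def)
      have "inj_on ?f X"
      proof (rule inj_onI)
        fix s t assume st: "s \<in> X" "t \<in> X" "?f s = ?f t"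
        then have "s \<in> S \<longleftrightarrow> t \<in> S" using J \<psi>(2) by (metis DiffE DiffI)
        then show "s = t"
          using st \<phi>(1) \<psi>(1) by (auto split: if_splits dest: inj_onD)
      qed
      then show ?thesis using \<phi>(2) \<psi>(2) by (intro exI[of _ ?f]) auto
    next
      case False
      obtain x where x: "x \<in> X" using \<open>X \<noteq> {}\<close> by blast
      have "card {x} \<le> card (J K {x})" using x by (intro hall) auto
      then obtain j where j: "j \<in> K" "x \<in> A j"
        using finJ[of "{x}"] by (auto simp: J_def card_gt_0_iff Suc_le_eq)
      \<comment> \<open>Every nonempty proper subset now has a spare neighbour, so losing the single
        index \<open>j\<close> does no harm.\<close>
      have "card S \<le> card (J (K - {j}) S)" if S: "S \<subseteq> X - {x}" for S
      proof (cases "S = {}")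
        case False
        moreover have "S \<subset> X" using S x by auto
        ultimately have "card S < card (J K S)"
          using \<open>\<not> (\<exists>S. S \<noteq> {} \<and> S \<subset> X \<and> card (J K S) \<le> card S)\<close> not_le by blast
        also have "card (J K S) \<le> card (insert j (J (K - {j}) S))"
          using less.prems(2) by (intro card_mono) (auto simp: J_def)
        also have "\<dots> \<le> Suc (card (J (K - {j}) S))"
          using less.prems(2) by (simp add: J_def card_insert_if)
        finally show ?thesis by simp
      qed simp
      then obtain \<phi> where \<phi>: "inj_on \<phi> (X - {x})" "\<forall>t\<in>X - {x}. \<phi> t \<in> K - {j} \<and> t \<in> A (\<phi> t)"
        using IH[of "X - {x}" "K - {j}"] x by auto
      have "inj_on (\<phi>(x := j)) X"
        using \<phi> by (auto simp: inj_on_def)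
      then show ?thesis using \<phi>(2) j by (intro exI[of _ "\<phi>(x := j)"]) auto
    qed
  qed simp
qed

lemma partial_transversal_iff:
  "partial_transversal n A X \<longleftrightarrow>
     finite X \<and> (\<forall>S\<subseteq>X. card S \<le> card {j. j < n \<and> A j \<inter> S \<noteq> {}})"
proof
  assume "partial_transversal n A X"
  then obtain \<phi> where \<phi>: "inj_on \<phi> X" "\<forall>t\<in>X. \<phi> t < n \<and> t \<in> A (\<phi> t)"
    by (auto simp: partial_transversal_def)
  have "finite X" using \<phi> by (intro inj_on_finite[of \<phi> X "{..<n}"]) auto
  moreover have "card S \<le> card {j. j < n \<and> A j \<inter> S \<noteq> {}}" if "S \<subseteq> X" for S
    using \<phi> that by (intro card_inj_on_le[of \<phi>]) (auto intro: inj_on_subset)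
  ultimately show "finite X \<and> (\<forall>S\<subseteq>X. card S \<le> card {j. j < n \<and> A j \<inter> S \<noteq> {}})" by blast
next
  assume "finite X \<and> (\<forall>S\<subseteq>X. card S \<le> card {j. j < n \<and> A j \<inter> S \<noteq> {}})"
  then show "partial_transversal n A X"
    using marriage[of X "{..<n}" A] by (auto simp: partial_transversal_def)
qed

subsection \<open>The Mason--Ingleton condition\<close>

definition up_closed :: "'e set set \<Rightarrow> 'e set set \<Rightarrow> bool" where
  "up_closed P U \<longleftrightarrow> U \<subseteq> P \<and> (\<forall>X\<in>U. \<forall>Y\<in>P. X \<subseteq> Y \<longrightarrow> Y \<in> U)"

text \<open>The weights are the Moebius inversion of \<open>N - r X\<close> over \<open>P\<close>,
  given implicitly by their sums over principal up-sets. The function \<open>r\<close> is defined on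
  all sets because it is evaluated at \<open>\<Inter>U\<close>, which need not belong to
  \<open>P\<close>.\<close>

definition mason_ingleton :: "'e set set \<Rightarrow> ('e set \<Rightarrow> int) \<Rightarrow> bool" where
  "mason_ingleton P r \<longleftrightarrow>
     (\<forall>\<gamma> N. (\<forall>X\<in>P. (\<Sum>Y | Y \<in> P \<and> X \<subseteq> Y. \<gamma> Y) = N - r X) \<longrightarrow>
       (\<forall>U. up_closed P U \<longrightarrow> U \<noteq> {} \<longrightarrow> sum \<gamma> U \<le> N - r (\<Inter>U)))"

text \<open>Uniqueness of Moebius inversion: such a \<open>d\<close> equals \<open>c\<close> at the
  top and vanishes elsewhere, and every nonempty up-set contains the top. It is meant for the
  difference of two weight functions.\<close>

lemma sum_up_closed_const:
  fixes d :: "'e set \<Rightarrow> int"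
  assumes fin: "finite P" and T: "T \<in> P" "\<And>X. X \<in> P \<Longrightarrow> X \<subseteq> T"
    and d: "\<And>X. X \<in> P \<Longrightarrow> (\<Sum>Y | Y \<in> P \<and> X \<subseteq> Y. d Y) = c"
    and U: "up_closed P U" "U \<noteq> {}"
  shows "sum d U = c"
proof -
  have "{Y. Y \<in> P \<and> T \<subseteq> Y} = {T}" using T by auto
  then have dT: "d T = c" using d[OF T(1)] by simp
  have zero: "d X = 0" if "X \<in> P" "X \<noteq> T" for X
    using that
  proof (induction "card {Y\<in>P. X \<subset> Y}" arbitrary: X rule: less_induct)
    case less
    have "d Y = 0" if Y: "Y \<in> P" "X \<subset> Y" "Y \<noteq> T" for Y
    proof -
      have "{Z\<in>P. Y \<subset> Z} \<subset> {Z\<in>P. X \<subset> Z}" using Y by auto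
      then have "card {Z\<in>P. Y \<subset> Z} < card {Z\<in>P. X \<subset> Z}"
        using fin by (intro psubset_card_mono) auto
      then show ?thesis using less.hyps Y by blast
    qed
    then have "(\<Sum>Y | Y \<in> P \<and> X \<subseteq> Y. d Y) = sum d {X, T}"
      using fin T(1) T(2)[OF less.prems(1)] less.prems by (intro sum.mono_neutral_right) auto
    then show ?case using d[OF less.prems(1)] dT less.prems by simp
  qed
  have "sum d U = sum d {T}"
    using fin T U zero by (intro sum.mono_neutral_right) (auto simp: up_closed_def intro: finite_subset)
  then show ?thesis using dT by simp
qed

text \<open>The weights are determined by \<open>N\<close>, and \<open>N\<close> only affects the weight of the top element.\<close>

lemma mason_ingletonI:
  assumes fin: "finite P" and T: "T \<in> P" "\<And>X. X \<in> P \<Longrightarrow> X \<subseteq> T"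
    and \<gamma>: "\<And>X. X \<in> P \<Longrightarrow> (\<Sum>Y | Y \<in> P \<and> X \<subseteq> Y. \<gamma> Y) = N - r X"
    and le: "\<And>U. up_closed P U \<Longrightarrow> U \<noteq> {} \<Longrightarrow> sum \<gamma> U \<le> N - r (\<Inter>U)"
  shows "mason_ingleton P r"
  unfolding mason_ingleton_def
proof (intro allI impI)
  fix \<gamma>' N' U
  assume \<gamma>': "\<forall>X\<in>P. (\<Sum>Y | Y \<in> P \<and> X \<subseteq> Y. \<gamma>' Y) = N' - r X"
    and U: "up_closed P U" "U \<noteq> {}"
  have "sum (\<lambda>Y. \<gamma>' Y - \<gamma> Y) U = N' - N"
  proof (rule sum_up_closed_const[OF fin T _ U])
    show "(\<Sum>Y | Y \<in> P \<and> X \<subseteq> Y. \<gamma>' Y - \<gamma> Y) = N' - N" if "X \<in> P" for X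
      using \<gamma>[OF that] bspec[OF \<gamma>' that] by (simp add: sum_subtractf)
  qed
  then show "sum \<gamma>' U \<le> N' - r (\<Inter>U)"
    using le[OF U] by (simp add: sum_subtractf)
qed

text \<open>The weight of a minimal element occurs only in the sum belonging to that element, so it
  can be chosen after all the others.\<close>

lemma exists_up_weights:
  fixes g :: "'e set \<Rightarrow> int"
  assumes "finite P"
  shows "\<exists>\<gamma>. \<forall>X\<in>P. (\<Sum>Y | Y \<in> P \<and> X \<subseteq> Y. \<gamma> Y) = g X"
  using assms
proof (induction P rule: finite_remove_induct)
  case (remove P)
  obtain M where M: "M \<in> P" "\<forall>X\<in>P. X \<subseteq> M \<longrightarrow> M = X"
    using finite_has_minimal[OF remove(1,2)] by auto
  obtain \<gamma> where \<gamma>: "\<forall>X\<in>P - {M}. (\<Sum>Y | Y \<in> P - {M} \<and> X \<subseteq> Y. \<gamma> Y) = g X"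
    using remove(4)[OF M(1)] by blast
  let ?\<gamma> = "\<gamma>(M := g M - (\<Sum>Y | Y \<in> P - {M} \<and> M \<subseteq> Y. \<gamma> Y))"
  have "(\<Sum>Y | Y \<in> P \<and> X \<subseteq> Y. ?\<gamma> Y) = g X" if X: "X \<in> P" for X
  proof (cases "X = M")
    case True
    have "{Y. Y \<in> P \<and> M \<subseteq> Y} = insert M {Y. Y \<in> P - {M} \<and> M \<subseteq> Y}" using M by auto
    then have "(\<Sum>Y | Y \<in> P \<and> M \<subseteq> Y. ?\<gamma> Y) = ?\<gamma> M + (\<Sum>Y | Y \<in> P - {M} \<and> M \<subseteq> Y. ?\<gamma> Y)"
      using remove(1) by simp
    also have "(\<Sum>Y | Y \<in> P - {M} \<and> M \<subseteq> Y. ?\<gamma> Y) = (\<Sum>Y | Y \<in> P - {M} \<and> M \<subseteq> Y. \<gamma> Y)"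
      by (rule sum.cong) auto
    finally show ?thesis using True by simp
  next
    case False
    then have "{Y. Y \<in> P \<and> X \<subseteq> Y} = {Y. Y \<in> P - {M} \<and> X \<subseteq> Y}" using M X by auto
    then have "(\<Sum>Y | Y \<in> P \<and> X \<subseteq> Y. ?\<gamma> Y) = (\<Sum>Y | Y \<in> P - {M} \<and> X \<subseteq> Y. \<gamma> Y)"
      by (intro sum.cong) auto
    then show ?thesis using \<gamma> X False by simp
  qed
  then show ?case by blast
qed simp

section \<open>From presentations to the Mason--Ingleton inequality and back\<close>

context matroid
begin

context
  fixes n :: nat and A :: "nat \<Rightarrow> 'e set"
  assumes presentation: "\<And>X. indep X \<longleftrightarrow> partial_transversal n A X"
begin

lemma rank_le_card_meeting: "rank indep X \<le> card {j. j < n \<and> A j \<inter> X \<noteq> {}}"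
proof -
  obtain B where B: "indep B" "B \<subseteq> X" "card B = rank indep X"
    by (rule obtain_rank)
  then have "card B \<le> card {j. j < n \<and> A j \<inter> B \<noteq> {}}"
    using presentation partial_transversal_iff by blast
  also have "\<dots> \<le> card {j. j < n \<and> A j \<inter> X \<noteq> {}}"
    using B by (intro card_mono) auto
  finally show ?thesis using B by simp
qed

text \<open>The defect form of Hall's theorem. With \<open>d\<close> the largest deficiency of a
  subset, adding \<open>d\<close> dummy sets equal to \<open>X\<close> makes all of \<open>X\<close>
  matchable; the elements matched to genuine sets are independent and omit at most \<open>d\<close>
  elements.\<close>

lemma obtain_defect_set:
  assumes X: "finite X"
  obtains Y where "Y \<subseteq> X" "card {j. j < n \<and> A j \<inter> Y \<noteq> {}} + card (X - Y) \<le> rank indep X"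
proof -
  define J where "J S = {j. j < n \<and> A j \<inter> S \<noteq> {}}" for S
  define \<delta> where "\<delta> S = int (card S) - int (card (J S))" for S
  have "Max (\<delta> ` Pow X) \<in> \<delta> ` Pow X" using X by (intro Max_in) auto
  then obtain Y where Y: "Y \<subseteq> X" "\<delta> Y = Max (\<delta> ` Pow X)" by auto
  have max: "\<delta> S \<le> \<delta> Y" if "S \<subseteq> X" for S
    using X that by (simp add: Y(2))
  define d where "d = nat (\<delta> Y)"
  \<comment> \<open>The empty set has deficiency zero, so the maximum is nonnegative and
    \<open>nat\<close> loses nothing.\<close>
  have d: "int d = \<delta> Y" using max[of "{}"] by (simp add: d_def) (simp add: \<delta>_def J_def)
  define A' where "A' j = (if j < n then A j else X)" for j
  have "card S \<le> card {j\<in>{..<n + d}. A' j \<inter> S \<noteq> {}}" if S: "S \<subseteq> X" for S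
  proof (cases "S = {}")
    case False
    have "{j\<in>{..<n + d}. A' j \<inter> S \<noteq> {}} = J S \<union> {n..<n + d}"
      using False S by (auto simp: A'_def J_def)
    moreover have "card (J S \<union> {n..<n + d}) = card (J S) + d"
      by (subst card_Un_disjoint) (auto simp: J_def)
    ultimately show ?thesis using max[OF S] d by (simp add: \<delta>_def)
  qed simp
  then obtain \<phi> where \<phi>: "inj_on \<phi> X" "\<forall>t\<in>X. \<phi> t \<in> {..<n + d} \<and> t \<in> A' (\<phi> t)"
    using marriage[of X "{..<n + d}" A'] X by auto
  define T where "T = {t\<in>X. \<phi> t < n}"
  have "inj_on \<phi> T" using \<phi>(1) by (rule inj_on_subset) (auto simp: T_def)
  then have "indep T"
    unfolding presentation partial_transversal_def
    using \<phi>(2) by (intro exI[of _ \<phi>]) (auto simp: T_def A'_def)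
  then have "card T \<le> rank indep X" by (rule card_le_rank) (auto simp: T_def)
  moreover have "card (X - T) \<le> card {n..<n + d}"
    using \<phi> by (intro card_inj_on_le[of \<phi>]) (auto simp: T_def intro: inj_on_subset)
  moreover have "card X = card T + card (X - T)"
    using X by (simp add: T_def card_Diff_subset card_mono)
  moreover have "card X = card Y + card (X - Y)"
    using X Y by (simp add: card_Diff_subset card_mono finite_subset)
  ultimately have "card (J Y) + card (X - Y) \<le> rank indep X"
    using d by (simp add: \<delta>_def)
  then show ?thesis using that Y(1) by (simp add: J_def)
qed

text \<open>If the defect set \<open>Y\<close> missed some \<open>e\<close> in \<open>X\<close>, the
  bound obtained from \<open>Y\<close> would drop when \<open>e\<close> is deleted, making
  \<open>e\<close> an isthmus of \<open>X\<close>.\<close>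

lemma rank_cyclic:
  assumes X: "finite X" "cyclic X"
  shows "rank indep X = card {j. j < n \<and> A j \<inter> X \<noteq> {}}"
proof -
  obtain Y where Y: "Y \<subseteq> X" "card {j. j < n \<and> A j \<inter> Y \<noteq> {}} + card (X - Y) \<le> rank indep X"
    using obtain_defect_set[OF X(1)] .
  have "Y = X"
  proof (rule ccontr)
    assume "Y \<noteq> X"
    then obtain e where e: "e \<in> X" "e \<notin> Y" using Y by auto
    have "rank indep (X - {e}) \<le> rank indep (Y \<union> (X - {e} - Y))" by (rule rank_mono) auto
    also have "\<dots> \<le> rank indep Y + card (X - {e} - Y)"
      using X by (intro rank_Un_le) auto
    also have "\<dots> \<le> card {j. j < n \<and> A j \<inter> Y \<noteq> {}} + card (X - {e} - Y)"
      using rank_le_card_meeting by simp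
    also have "card (X - {e} - Y) < card (X - Y)"
      using X e by (intro psubset_card_mono) auto
    finally show False using Y(2) X(2) e by (simp add: cyclic_def)
  qed
  then show ?thesis using Y(2) rank_le_card_meeting[of X] by simp
qed

lemma mason_ingleton_cyclic_flats:
  "mason_ingleton {X. cyclic_flat ground indep X} (\<lambda>X. int (rank indep X))"
proof -
  let ?Z = "{X. cyclic_flat ground indep X}"
  define J where "J S = {j. j < n \<and> A j \<inter> S \<noteq> {}}" for S
  \<comment> \<open>This is the largest cyclic flat disjoint from \<open>A j\<close>; that the
    closure stays disjoint is shown in \<open>disj\<close>.\<close>
  define c where "c j = closure (\<Union>{X\<in>?Z. A j \<inter> X = {}})" for j
  define \<gamma> where "\<gamma> Y = int (card {j. j < n \<and> c j = Y})" for Y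
  have sub: "X \<subseteq> ground" and cyc: "cyclic X" if "X \<in> ?Z" for X
    using that by (auto simp: cyclic_flat_iff flat_def)
  have fin: "finite X" if "X \<subseteq> ground" for X
    using that finite_ground finite_subset by blast
  have rJ: "rank indep X = card (J X)" if "X \<subseteq> ground" "cyclic X" for X
    using rank_cyclic fin that by (simp add: J_def)
  \<comment> \<open>Admitting \<open>X = {}\<close> makes the second fact available without naming a
    member of the family.\<close>
  have cl: "X \<subseteq> closure (\<Union>\<X>)" "closure (\<Union>\<X>) \<in> ?Z" if "\<X> \<subseteq> ?Z" "X \<in> insert {} \<X>" for X \<X>
  proof -
    have "\<Union>\<X> \<subseteq> ground" "cyclic (\<Union>\<X>)" using that sub cyc by (blast, intro cyclic_Union) blast
    then show "X \<subseteq> closure (\<Union>\<X>)" "closure (\<Union>\<X>) \<in> ?Z"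
      using subset_closure cyclic_flat_closure that(2) by blast+
  qed
  have cZ: "c j \<in> ?Z" for j unfolding c_def by (rule cl(2)[of _ "{}"]) auto
  have disj: "A j \<inter> c j = {}" if "j < n" for j
  proof -
    define W where "W = \<Union>{X\<in>?Z. A j \<inter> X = {}}"
    have W: "W \<subseteq> ground" "cyclic W" "A j \<inter> W = {}"
      using sub cyc by (auto simp: W_def intro!: cyclic_Union)
    \<comment> \<open>Both sets are cyclic and have the same rank, so they meet equally many sets of
      the presentation. By inclusion they meet the same ones, hence \<open>A j\<close> misses the
      closure as well.\<close>
    have "card (J (closure W)) = card (J W)"
      using rJ[of W] rJ[of "closure W"] W cyclic_flat_closure[OF W(1,2)] rank_closure[OF W(1)] closure_subset_ground
      by (simp add: cyclic_flat_iff)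
    moreover have "J W \<subseteq> J (closure W)" using subset_closure[OF W(1)] by (auto simp: J_def)
    ultimately have "J W = J (closure W)" by (intro card_subset_eq) (auto simp: J_def)
    then show ?thesis using W(3) that by (auto simp: J_def c_def W_def)
  qed
  have c_iff: "X \<subseteq> c j \<longleftrightarrow> A j \<inter> X = {}" if "j < n" "X \<in> ?Z" for j X
  proof
    assume "A j \<inter> X = {}"
    then show "X \<subseteq> c j" using that unfolding c_def by (intro cl(1)) auto
  qed (use disj that in auto)
  have sum: "sum \<gamma> U = int (card {j. j < n \<and> c j \<in> U})" if "U \<subseteq> ?Z" for U
  proof -
    have "finite U" using that finite_cyclic_flats finite_subset by blast
    then have "card (\<Union>Y\<in>U. {j. j < n \<and> c j = Y}) = (\<Sum>Y\<in>U. card {j. j < n \<and> c j = Y})"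
      by (intro card_UN_disjoint) auto
    moreover have "(\<Union>Y\<in>U. {j. j < n \<and> c j = Y}) = {j. j < n \<and> c j \<in> U}" by auto
    ultimately show ?thesis by (simp add: \<gamma>_def)
  qed
  have co: "int (card ({..<n} - J S)) = int n - int (card (J S))" for S
  proof -
    have "J S \<subseteq> {..<n}" by (auto simp: J_def)
    then show ?thesis using card_mono[of "{..<n}" "J S"] by (simp add: card_Diff_subset finite_subset)
  qed
  show ?thesis
  proof (rule mason_ingletonI[where T = "closure (\<Union>?Z)" and \<gamma> = \<gamma> and N = "int n"])
    show "finite ?Z" by (rule finite_cyclic_flats)
    show "closure (\<Union>?Z) \<in> ?Z" by (rule cl(2)[of _ "{}"]) auto
    show "X \<subseteq> closure (\<Union>?Z)" if "X \<in> ?Z" for X using that by (intro cl(1)) auto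
  next
    fix X assume X: "X \<in> ?Z"
    have "(\<Sum>Y | Y \<in> ?Z \<and> X \<subseteq> Y. \<gamma> Y) = int (card {j. j < n \<and> c j \<in> {Y. Y \<in> ?Z \<and> X \<subseteq> Y}})"
      by (rule sum) auto
    also have "{j. j < n \<and> c j \<in> {Y. Y \<in> ?Z \<and> X \<subseteq> Y}} = {..<n} - J X"
      using c_iff[OF _ X] cZ by (auto simp: J_def)
    also have "int (card \<dots>) = int n - int (rank indep X)"
      using co rJ sub[OF X] cyc[OF X] by simp
    finally show "(\<Sum>Y | Y \<in> ?Z \<and> X \<subseteq> Y. \<gamma> Y) = int n - int (rank indep X)" .
  next
    fix U assume U: "up_closed ?Z U" "U \<noteq> {}"
    have "sum \<gamma> U = int (card {j. j < n \<and> c j \<in> U})"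
      using U by (intro sum) (auto simp: up_closed_def)
    \<comment> \<open>A set \<open>A j\<close> with \<open>c j\<close> in \<open>U\<close> misses
      \<open>c j\<close> and hence the smaller \<open>\<Inter>U\<close>. The intersection need not
      be cyclic, so its rank is only bounded by the number of sets meeting it.\<close>
    also have "\<dots> \<le> int (card ({..<n} - J (\<Inter>U)))"
      using disj by (intro of_nat_mono card_mono) (auto simp: J_def)
    also have "\<dots> \<le> int n - int (rank indep (\<Inter>U))"
      using co rank_le_card_meeting by (simp add: J_def)
    finally show "sum \<gamma> U \<le> int n - int (rank indep (\<Inter>U))" .
  qed
qed

end

text \<open>For an independent set, the inequality at the up-set of cyclic flats containing a subset
  \<open>S\<close> is exactly Hall's condition for \<open>S\<close>. Conversely, a partial
  transversal meets each cyclic flat in at most its rank, which suffices for independence.\<close>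

lemma transversal_if_mason_ingleton:
  assumes MI: "mason_ingleton {X. cyclic_flat ground indep X} (\<lambda>X. int (rank indep X))"
  shows "transversal ground indep"
proof -
  define Z where "Z = {X. cyclic_flat ground indep X}"
  \<comment> \<open>With this choice the required bounds also hold for an empty family of cyclic
    flats, a case outside the hypothesis.\<close>
  define N where "N = int (rank indep ground)"
  have finZ: "finite Z" unfolding Z_def by (rule finite_cyclic_flats)
  have sub: "X \<subseteq> ground" if "X \<in> Z" for X
    using that by (auto simp: Z_def cyclic_flat_def flat_def)
  obtain \<gamma> where \<gamma>: "\<forall>X\<in>Z. (\<Sum>Y | Y \<in> Z \<and> X \<subseteq> Y. \<gamma> Y) = N - int (rank indep X)"
    using exists_up_weights[OF finZ, of "\<lambda>X. N - int (rank indep X)"] by blast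
  have le: "sum \<gamma> U \<le> N - int (rank indep (\<Inter>U))" if "up_closed Z U" "U \<noteq> {}" for U
    using MI \<gamma> that unfolding mason_ingleton_def Z_def[symmetric] by blast
  \<comment> \<open>The weight of \<open>X\<close> is the slack in the inequality for the cyclic
    flats strictly above \<open>X\<close>, whose intersection contains \<open>X\<close>.\<close>
  have nonneg: "\<gamma> X \<ge> 0" if X: "X \<in> Z" for X
  proof -
    let ?U = "{Y. Y \<in> Z \<and> X \<subset> Y}"
    have "{Y. Y \<in> Z \<and> X \<subseteq> Y} = insert X ?U" using X by auto
    then have eq: "\<gamma> X + sum \<gamma> ?U = N - int (rank indep X)"
      using \<gamma> X finZ by auto
    have "sum \<gamma> ?U \<le> N - int (rank indep X)"
    proof (cases "?U = {}")
      case True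
      show ?thesis unfolding True using rank_mono[OF sub[OF X]] by (simp add: N_def)
    next
      case False
      have "rank indep X \<le> rank indep (\<Inter>?U)" by (rule rank_mono) auto
      moreover have "up_closed Z ?U" by (auto simp: up_closed_def)
      ultimately show ?thesis using le[OF _ False] by force
    qed
    then show ?thesis using eq by simp
  qed
  \<comment> \<open>The required copies, tagged by numbers; enumerating them turns the multiset into
    a sequence indexed by \<open>j < n\<close>.\<close>
  define S where "S = (SIGMA Y:Z. {..<nat (\<gamma> Y)})"
  have finS: "finite S" using finZ by (simp add: S_def)
  obtain b where b: "bij_betw b {0..<card S} S"
    using ex_bij_betw_nat_finite[OF finS] by blast
  define n where "n = card S"
  define c where "c j = fst (b j)" for j
  have cZ: "c j \<in> Z" if "j < n" for j
    using bij_betwE[OF b] that by (force simp: n_def c_def S_def)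
  have count: "int (card {j. j < n \<and> c j \<in> U}) = sum \<gamma> U" if U: "U \<subseteq> Z" for U
  proof -
    have "b ` {j. j < n \<and> c j \<in> U} = {p \<in> b ` {0..<card S}. fst p \<in> U}"
      by (auto simp: c_def n_def)
    then have "bij_betw b {j. j < n \<and> c j \<in> U} {p\<in>S. fst p \<in> U}"
      using b by (auto simp: bij_betw_def n_def intro: inj_on_subset)
    then have "card {j. j < n \<and> c j \<in> U} = card {p\<in>S. fst p \<in> U}" by (rule bij_betw_same_card)
    also have "{p\<in>S. fst p \<in> U} = (SIGMA Y:U. {..<nat (\<gamma> Y)})" using U by (auto simp: S_def)
    also have "card \<dots> = (\<Sum>Y\<in>U. nat (\<gamma> Y))"
      using finite_subset[OF U finZ] by simp
    finally show ?thesis using nonneg U by (simp add: subset_iff)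
  qed
  \<comment> \<open>The least cyclic flat has rank zero, so the total weight, which is the number of
    copies, is \<open>N\<close>.\<close>
  have "{Y. Y \<in> Z \<and> closure {} \<subseteq> Y} = Z"
    using closure_subset_flat[of _ "{}"] by (auto simp: Z_def cyclic_flat_def)
  then have sumZ: "sum \<gamma> Z = N"
    using bspec[OF \<gamma>, of "closure {}"] cyclic_flat_closure_empty rank_closure[of "{}"] by (simp add: Z_def)
  have "{j. j < n \<and> c j \<in> Z} = {..<n}" using cZ by auto
  then have n: "int n = N" using count[of Z] sumZ by simp
  define A where "A j = ground - c j" for j
  \<comment> \<open>A complement \<open>A j\<close> misses \<open>X\<close> precisely when
    \<open>X\<close> lies in \<open>c j\<close>.\<close>
  have meet: "int (card {j. j < n \<and> A j \<inter> X \<noteq> {}}) = N - (\<Sum>Y | Y \<in> Z \<and> X \<subseteq> Y. \<gamma> Y)"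
    if X: "X \<subseteq> ground" for X
  proof -
    have "{j. j < n \<and> A j \<inter> X \<noteq> {}} = {..<n} - {j. j < n \<and> c j \<in> {Y. Y \<in> Z \<and> X \<subseteq> Y}}"
      using X cZ by (auto simp: A_def)
    moreover have "card ({..<n} - {j. j < n \<and> c j \<in> {Y. Y \<in> Z \<and> X \<subseteq> Y}})
        = n - card {j. j < n \<and> c j \<in> {Y. Y \<in> Z \<and> X \<subseteq> Y}}"
      by (subst card_Diff_subset) (auto intro: finite_subset[of _ "{..<n}"])
    moreover have "card {j. j < n \<and> c j \<in> {Y. Y \<in> Z \<and> X \<subseteq> Y}} \<le> card {..<n}"
      by (rule card_mono) auto
    ultimately show ?thesis using count[of "{Y. Y \<in> Z \<and> X \<subseteq> Y}"] n by auto
  qed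
  have "indep X \<longleftrightarrow> partial_transversal n A X" for X
  proof
    assume ind: "indep X"
    have "card S \<le> card {j. j < n \<and> A j \<inter> S \<noteq> {}}" if "S \<subseteq> X" for S
    proof -
      have S: "S \<subseteq> ground" "card S = rank indep S"
        using indep_mono[OF ind that] indep_subset_ground indep_iff_rank[of S] indep_finite[of S] by auto
      let ?U = "{Y. Y \<in> Z \<and> S \<subseteq> Y}"
      have "sum \<gamma> ?U \<le> N - int (rank indep S)"
      proof (cases "?U = {}")
        case True
        show ?thesis unfolding True using rank_mono[OF S(1)] by (simp add: N_def)
      next
        case False
        have "rank indep S \<le> rank indep (\<Inter>?U)" by (rule rank_mono) auto
        moreover have "up_closed Z ?U" by (auto simp: up_closed_def)
        ultimately show ?thesis using le[OF _ False] by force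
      qed
      then show ?thesis using meet[OF S(1)] S(2) by simp
    qed
    then show "partial_transversal n A X"
      using indep_finite[OF ind] by (simp add: partial_transversal_iff)
  next
    assume pt: "partial_transversal n A X"
    then have X: "X \<subseteq> ground" by (auto simp: partial_transversal_def A_def)
    have "card (X \<inter> Y) \<le> rank indep Y" if Y: "Y \<in> Z" for Y
    proof -
      have "int (card (X \<inter> Y)) \<le> int (card {j. j < n \<and> A j \<inter> (X \<inter> Y) \<noteq> {}})"
        using pt by (simp add: partial_transversal_iff)
      also have "\<dots> \<le> int (card {j. j < n \<and> A j \<inter> Y \<noteq> {}})"
        by (intro of_nat_mono card_mono) auto
      also have "\<dots> = int (rank indep Y)"
        using meet[OF sub[OF Y]] \<gamma> Y by simp
      finally show ?thesis by simp
    qed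
    then show "indep X" using indep_iff_cyclic_flats[OF X] by (simp add: Z_def)
  qed
  then show ?thesis unfolding transversal_def by (intro exI[of _ n] exI[of _ A]) (auto simp: A_def)
qed

theorem transversal_iff_mason_ingleton:
  "transversal ground indep \<longleftrightarrow>
     mason_ingleton {X. cyclic_flat ground indep X} (\<lambda>X. int (rank indep X))"
  using mason_ingleton_cyclic_flats transversal_if_mason_ingleton
  unfolding transversal_def by blast

end

subsection \<open>Intervals of cyclic flats\<close>

context matroid
begin

text \<open>
  The minor \<open>M|T/B\<close>, except that the elements of \<open>B\<close> are kept as loops.  Its cyclic flats are then
  literally those of \<open>M\<close> between \<open>B\<close> and \<open>T\<close>.
\<close>

definition minor_indep :: "'e set \<Rightarrow> 'e set \<Rightarrow> 'e set \<Rightarrow> bool" where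
  "minor_indep B T Y \<longleftrightarrow> Y \<subseteq> T - B \<and> rank indep (Y \<union> B) = card Y + rank indep B"

context
  fixes B T
  assumes B: "B \<subseteq> T" and T: "T \<subseteq> ground"
begin

lemma finite_subset_minor: "X \<subseteq> T \<Longrightarrow> finite X"
  by (rule finite_subset[OF _ finite_subset[OF T finite_ground]])

lemma minor_indep_insert:
  assumes Y: "minor_indep B T Y" and y: "y \<in> T" "rank indep (insert y (Y \<union> B)) \<noteq> rank indep (Y \<union> B)"
  shows "minor_indep B T (insert y Y)" "y \<notin> Y"
proof -
  have yn: "y \<notin> Y \<union> B" using y(2) by (auto simp: insert_absorb)
  then show "y \<notin> Y" by simp
  have "finite Y" using Y finite_subset_minor by (auto simp: minor_indep_def)
  moreover have "rank indep (insert y (Y \<union> B)) \<le> rank indep (Y \<union> B) + 1"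
    using rank_Un_le[of "{y}" "Y \<union> B"] by simp
  moreover have "rank indep (Y \<union> B) \<le> rank indep (insert y (Y \<union> B))"
    by (rule rank_mono) auto
  ultimately show "minor_indep B T (insert y Y)"
    using Y y yn by (auto simp: minor_indep_def)
qed

lemma matroid_minor: "matroid T (minor_indep B T)"
proof
  show "finite T" by (simp add: finite_subset_minor)
  show "X \<subseteq> T" if "minor_indep B T X" for X using that by (auto simp: minor_indep_def)
  show "minor_indep B T {}" by (simp add: minor_indep_def)
  show "minor_indep B T X" if Y: "minor_indep B T Y" and XY: "X \<subseteq> Y" for X Y
  proof -
    have fin: "finite Y" using Y finite_subset_minor by (auto simp: minor_indep_def)
    have "rank indep (Y \<union> B) = rank indep ((X \<union> B) \<union> (Y - X))"
      using XY by (intro arg_cong[where f = "rank indep"]) auto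
    also have "\<dots> \<le> rank indep (X \<union> B) + card (Y - X)"
      using fin by (intro rank_Un_le) auto
    finally have "card Y + rank indep B \<le> rank indep (X \<union> B) + card (Y - X)"
      using Y by (simp add: minor_indep_def)
    moreover have "card Y = card X + card (Y - X)"
      using fin XY by (simp add: card_Diff_subset card_mono finite_subset)
    moreover have "rank indep (B \<union> X) \<le> rank indep B + card X"
      using fin XY by (intro rank_Un_le) (auto intro: finite_subset)
    ultimately show ?thesis using Y XY by (auto simp: minor_indep_def Un_commute)
  qed
  show "\<exists>y\<in>Y - X. minor_indep B T (insert y X)"
    if X: "minor_indep B T X" and Y: "minor_indep B T Y" and lt: "card X < card Y" for X Y
  proof -
    \<comment> \<open>Otherwise \<open>X \<union> B\<close> would span \<open>Y\<close>,
      contradicting the larger rank of \<open>Y \<union> B\<close>.\<close>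
    have "\<exists>y\<in>Y. rank indep (insert y (X \<union> B)) \<noteq> rank indep (X \<union> B)"
    proof (rule ccontr)
      assume "\<not> ?thesis"
      then have "rank indep (X \<union> B \<union> Y) = rank indep (X \<union> B)" by (intro rank_Un_eq) auto
      moreover have "rank indep (Y \<union> B) \<le> rank indep (X \<union> B \<union> Y)" by (rule rank_mono) auto
      ultimately show False using X Y lt by (simp add: minor_indep_def)
    qed
    then obtain y where y: "y \<in> Y" "rank indep (insert y (X \<union> B)) \<noteq> rank indep (X \<union> B)" by blast
    moreover have "y \<in> T" using y(1) Y by (auto simp: minor_indep_def)
    ultimately show ?thesis using minor_indep_insert[OF X] by blast
  qed
qed

text \<open>A largest independent subset of \<open>X\<close> in the minor spans \<open>X\<close>
  together with \<open>B\<close>, since any element it failed to span could be added to it.\<close>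

lemma rank_minor:
  assumes X: "X \<subseteq> T"
  shows "rank (minor_indep B T) X + rank indep B = rank indep (X \<union> B)"
proof -
  interpret minor: matroid T "minor_indep B T" by (rule matroid_minor)
  obtain Y where Y: "minor_indep B T Y" "Y \<subseteq> X" "card Y = rank (minor_indep B T) X"
    by (rule minor.obtain_rank)
  have "rank indep (insert y (Y \<union> B)) = rank indep (Y \<union> B)" if y: "y \<in> X" for y
  proof (rule ccontr)
    assume "\<not> ?thesis"
    then have *: "minor_indep B T (insert y Y)" "y \<notin> Y"
      using minor_indep_insert[OF Y(1)] y X by auto
    then have "card (insert y Y) \<le> rank (minor_indep B T) X"
      using Y y by (intro minor.card_le_rank) auto
    then show False using * Y finite_subset_minor[of Y] X by auto
  qed
  then have "rank indep (Y \<union> B \<union> X) = rank indep (Y \<union> B)" by (rule rank_Un_eq)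
  moreover have "Y \<union> B \<union> X = X \<union> B" using Y by auto
  ultimately show ?thesis using Y by (simp add: minor_indep_def)
qed

text \<open>The elements of \<open>B\<close> are loops of the minor, so its flats contain
  \<open>B\<close>. Flatness of \<open>T\<close> excludes spanned elements outside \<open>T\<close>,
  and cyclicity of \<open>B\<close> ensures that elements of \<open>B\<close> are isthmuses neither
  in the minor nor in the original matroid.\<close>

lemma cyclic_flat_minor_iff:
  assumes cB: "cyclic B" and fT: "flat ground indep T"
  shows "cyclic_flat T (minor_indep B T) X \<longleftrightarrow> cyclic_flat ground indep X \<and> B \<subseteq> X \<and> X \<subseteq> T"
proof -
  interpret minor: matroid T "minor_indep B T" by (rule matroid_minor)
  have BX: "B \<subseteq> X" if fl: "flat T (minor_indep B T) X"
  proof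
    fix e assume e: "e \<in> B"
    have X: "X \<subseteq> T" using fl by (simp add: flat_def)
    have "rank (minor_indep B T) (insert e X) + rank indep B = rank indep (X \<union> B)"
      using rank_minor[of "insert e X"] e B X by (simp add: insert_absorb subset_iff)
    then have "rank (minor_indep B T) (insert e X) = rank (minor_indep B T) X"
      using rank_minor[OF X] by simp
    then show "e \<in> X" using fl e B by (force simp: flat_def)
  qed
  have "flat T (minor_indep B T) X \<and> minor.cyclic X \<longleftrightarrow> flat ground indep X \<and> cyclic X"
    if X: "B \<subseteq> X" "X \<subseteq> T"
  proof -
    have r: "rank (minor_indep B T) Y + rank indep B = rank indep Y" if "B \<subseteq> Y" "Y \<subseteq> T" for Y
      using rank_minor[OF that(2)] that(1) by (simp add: Un_absorb2)
    have ins: "rank (minor_indep B T) X < rank (minor_indep B T) (insert e X)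
        \<longleftrightarrow> rank indep X < rank indep (insert e X)" if "e \<in> T" for e
    proof -
      have "B \<subseteq> insert e X" "insert e X \<subseteq> T" using X that by auto
      then show ?thesis using r[OF X] r[of "insert e X"] by linarith
    qed
    have out: "rank indep X < rank indep (insert e X)" if e: "e \<in> ground - T" for e
    proof (rule ccontr)
      assume "\<not> ?thesis"
      then have "rank indep (insert e X) = rank indep X"
        using rank_mono[OF subset_insertI, of X e] by simp
      then have "rank indep (insert e T) = rank indep T"
        using X(2) by (rule rank_insert_eq_mono)
      then show False using fT e by (force simp: flat_def)
    qed
    have "flat T (minor_indep B T) X \<longleftrightarrow> flat ground indep X"
    proof -
      have "(\<forall>e\<in>T - X. rank indep X < rank indep (insert e X))
          \<longleftrightarrow> (\<forall>e\<in>ground - X. rank indep X < rank indep (insert e X))"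
        using out T by blast
      then show ?thesis using ins X T by (auto simp: flat_def)
    qed
    moreover have "rank (minor_indep B T) (X - {e}) = rank (minor_indep B T) X
        \<longleftrightarrow> rank indep (X - {e}) = rank indep X" if e: "e \<in> X" for e
    proof (cases "e \<in> B")
      case True
      then have "X - {e} \<union> B = X" using X by auto
      then have "rank (minor_indep B T) (X - {e}) + rank indep B = rank indep X"
        using rank_minor[of "X - {e}"] X by auto
      then show ?thesis using r[OF X] cyclic_imp_rank_remove[OF cB X(1) True] by simp
    next
      case False
      then have "B \<subseteq> X - {e}" "X - {e} \<subseteq> T" using X by auto
      then show ?thesis using r[of "X - {e}"] r[OF X] by linarith
    qed
    ultimately show ?thesis by (simp add: minor.cyclic_def cyclic_def)
  qed
  then show ?thesis
    using BX unfolding minor.cyclic_flat_iff cyclic_flat_iff by (auto simp: flat_def)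
qed

end

end

text \<open>A constant added to the rank is absorbed by \<open>N\<close>. Here the constant will be
  the rank of the contracted flat.\<close>

lemma mason_ingleton_cong_shift:
  assumes MI: "mason_ingleton P r"
    and r: "\<And>X. X \<in> P \<Longrightarrow> r' X = r X + k" "\<And>U. U \<subseteq> P \<Longrightarrow> U \<noteq> {} \<Longrightarrow> r' (\<Inter>U) = r (\<Inter>U) + k"
  shows "mason_ingleton P r'"
  unfolding mason_ingleton_def
proof (intro allI impI)
  fix \<gamma> N U
  assume \<gamma>: "\<forall>X\<in>P. (\<Sum>Y | Y \<in> P \<and> X \<subseteq> Y. \<gamma> Y) = N - r' X" and U: "up_closed P U" "U \<noteq> {}"
  have "\<forall>X\<in>P. (\<Sum>Y | Y \<in> P \<and> X \<subseteq> Y. \<gamma> Y) = (N - k) - r X"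
    using \<gamma> r(1) by simp
  then have "sum \<gamma> U \<le> (N - k) - r (\<Inter>U)" using MI U unfolding mason_ingleton_def by blast
  then show "sum \<gamma> U \<le> N - r' (\<Inter>U)" using r(2)[of U] U by (simp add: up_closed_def)
qed

lemma (in matroid) mason_ingleton_interval:
  assumes B: "cyclic_flat ground indep B" and T: "cyclic_flat ground indep T" and BT: "B \<subseteq> T"
    and tr: "transversal T (minor_indep B T)"
  shows "mason_ingleton {X. cyclic_flat ground indep X \<and> B \<subseteq> X \<and> X \<subseteq> T} (\<lambda>X. int (rank indep X))"
proof -
  have Tg: "T \<subseteq> ground" using T by (auto simp: cyclic_flat_def flat_def)
  interpret minor: matroid T "minor_indep B T" by (rule matroid_minor[OF BT Tg])
  let ?P = "{X. cyclic_flat ground indep X \<and> B \<subseteq> X \<and> X \<subseteq> T}"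
  have "{X. cyclic_flat T (minor_indep B T) X} = ?P"
    using cyclic_flat_minor_iff[OF BT Tg] B T by (simp add: cyclic_flat_iff)
  then have MI: "mason_ingleton ?P (\<lambda>X. int (rank (minor_indep B T) X))"
    using tr minor.transversal_iff_mason_ingleton by simp
  have r: "int (rank indep X) = int (rank (minor_indep B T) X) + int (rank indep B)"
    if "B \<subseteq> X" "X \<subseteq> T" for X
    using rank_minor[OF BT Tg that(2)] that(1) by (simp add: Un_absorb2)
  show ?thesis
  proof (rule mason_ingleton_cong_shift[OF MI])
    show "int (rank indep X) = int (rank (minor_indep B T) X) + int (rank indep B)"
      if "X \<in> ?P" for X using that r by simp
    show "int (rank indep (\<Inter>U)) = int (rank (minor_indep B T) (\<Inter>U)) + int (rank indep B)"
      if "U \<subseteq> ?P" "U \<noteq> {}" for U using that by (intro r) auto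
  qed
qed

subsection \<open>Lexicographic sums\<close>

lemma finite_lattice_bottom_top:
  assumes "finite_lattice L"
  shows "\<exists>b\<in>carrier L. \<forall>x\<in>carrier L. b \<sqsubseteq>\<^bsub>L\<^esub> x" "\<exists>t\<in>carrier L. \<forall>x\<in>carrier L. x \<sqsubseteq>\<^bsub>L\<^esub> t"
proof -
  interpret lattice L using assms by (simp add: finite_lattice_def)
  have *: "finite (carrier L)" "carrier L \<noteq> {}" using assms by (auto simp: finite_lattice_def)
  show "\<exists>b\<in>carrier L. \<forall>x\<in>carrier L. b \<sqsubseteq>\<^bsub>L\<^esub> x"
    using finite_inf_greatest[OF *(1) order_refl *(2)] by (auto simp: greatest_def Lower_def)
  show "\<exists>t\<in>carrier L. \<forall>x\<in>carrier L. x \<sqsubseteq>\<^bsub>L\<^esub> t"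
    using finite_sup_least[OF *(1) order_refl *(2)] by (auto simp: least_def Upper_def)
qed

lemma partial_order_lex_sum:
  assumes L: "partial_order L" and F: "\<And>x. x \<in> carrier L \<Longrightarrow> partial_order (F x)"
  shows "partial_order (lex_sum L F)"
proof -
  interpret L: partial_order L by fact
  have refl: "a \<sqsubseteq>\<^bsub>F x\<^esub> a" if "x \<in> carrier L" "a \<in> carrier (F x)" for x a
    by (rule weak_partial_order.le_refl[OF partial_order.axioms(1)[OF F[OF that(1)]] that(2)])
  have antisym: "a = b" if "x \<in> carrier L" "a \<in> carrier (F x)" "b \<in> carrier (F x)"
      "a \<sqsubseteq>\<^bsub>F x\<^esub> b" "b \<sqsubseteq>\<^bsub>F x\<^esub> a" for x a b
    by (rule partial_order.le_antisym[OF F[OF that(1)] that(4,5,2,3)])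
  have trans: "a \<sqsubseteq>\<^bsub>F x\<^esub> c" if "x \<in> carrier L" "a \<in> carrier (F x)" "b \<in> carrier (F x)" "c \<in> carrier (F x)"
      "a \<sqsubseteq>\<^bsub>F x\<^esub> b" "b \<sqsubseteq>\<^bsub>F x\<^esub> c" for x a b c
    by (rule weak_partial_order.le_trans[OF partial_order.axioms(1)[OF F[OF that(1)]] that(5,6,2,3,4)])
  have lantisym: False if "x \<sqsubseteq>\<^bsub>L\<^esub> y" "y \<sqsubseteq>\<^bsub>L\<^esub> x" "x \<noteq> y" "x \<in> carrier L" "y \<in> carrier L" for x y
    using L.le_antisym that by blast
  show ?thesis
  proof
    show "p \<sqsubseteq>\<^bsub>lex_sum L F\<^esub> p" if "p \<in> carrier (lex_sum L F)" for p
      using that refl by (auto simp: lex_sum_def)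
    show "p .=\<^bsub>lex_sum L F\<^esub> q"
      if "p \<sqsubseteq>\<^bsub>lex_sum L F\<^esub> q" "q \<sqsubseteq>\<^bsub>lex_sum L F\<^esub> p" "p \<in> carrier (lex_sum L F)" "q \<in> carrier (lex_sum L F)" for p q
      using that antisym lantisym by (auto simp: lex_sum_def L.lless_eq)
    show "p \<sqsubseteq>\<^bsub>lex_sum L F\<^esub> s"
      if "p \<sqsubseteq>\<^bsub>lex_sum L F\<^esub> q" "q \<sqsubseteq>\<^bsub>lex_sum L F\<^esub> s" "p \<in> carrier (lex_sum L F)" "q \<in> carrier (lex_sum L F)"
        "s \<in> carrier (lex_sum L F)" for p q s
      using that trans L.lless_trans by (auto simp: lex_sum_def)
  qed (auto simp: lex_sum_def)
qed

text \<open>Within one fibre the join is taken there. Over incomparable indices it is the bottom of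
  the fibre over their join, which is why fibres must have a least element.\<close>

lemma lex_sum_join_exists:
  assumes L: "lattice L" and F: "\<And>x. x \<in> carrier L \<Longrightarrow> finite_lattice (F x)"
    and pq: "p \<in> carrier (lex_sum L F)" "q \<in> carrier (lex_sum L F)"
  shows "\<exists>s. least (lex_sum L F) s (Upper (lex_sum L F) {p, q})"
proof -
  interpret L: lattice L by fact
  have lat: "lattice (F x)" if "x \<in> carrier L" for x
    using F[OF that] by (simp add: finite_lattice_def)
  interpret S: partial_order "lex_sum L F"
  proof (rule partial_order_lex_sum)
    show "partial_order (F x)" if "x \<in> carrier L" for x
      using lat[OF that] by (simp add: lattice_def upper_semilattice_def)
  qed (rule L.partial_order_axioms)
  obtain x a y b where p: "p = (x, a)" "q = (y, b)" by (cases p, cases q)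
  have c: "x \<in> carrier L" "y \<in> carrier L" "a \<in> carrier (F x)" "b \<in> carrier (F y)"
    using pq p by (auto simp: lex_sum_def)
  show ?thesis
  proof (cases "p \<sqsubseteq>\<^bsub>lex_sum L F\<^esub> q \<or> q \<sqsubseteq>\<^bsub>lex_sum L F\<^esub> p")
    case True
    then show ?thesis
    proof
      assume "p \<sqsubseteq>\<^bsub>lex_sum L F\<^esub> q"
      then have "least (lex_sum L F) q (Upper (lex_sum L F) {p, q})"
        using pq by (intro least_UpperI) auto
      then show ?thesis by blast
    next
      assume "q \<sqsubseteq>\<^bsub>lex_sum L F\<^esub> p"
      then have "least (lex_sum L F) p (Upper (lex_sum L F) {p, q})"
        using pq by (intro least_UpperI) auto
      then show ?thesis by blast
    qed
  next
    case incomp: False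
    show ?thesis
    proof (cases "x = y")
      case True
      interpret Fx: lattice "F x" by (rule lat[OF c(1)])
      obtain s where s: "least (F x) s (Upper (F x) {a, b})"
        using Fx.sup_of_two_exists c True by blast
      have sc: "s \<in> carrier (F x)" "a \<sqsubseteq>\<^bsub>F x\<^esub> s" "b \<sqsubseteq>\<^bsub>F x\<^esub> s"
        using s c True by (auto simp: least_def)
      have "least (lex_sum L F) (x, s) (Upper (lex_sum L F) {p, q})"
      proof (rule least_UpperI)
        fix t assume t: "t \<in> Upper (lex_sum L F) {p, q}"
        obtain z d where zd: "t = (z, d)" by (cases t)
        have tc: "z \<in> carrier L" "d \<in> carrier (F z)" "(x, a) \<sqsubseteq>\<^bsub>lex_sum L F\<^esub> (z, d)" "(x, b) \<sqsubseteq>\<^bsub>lex_sum L F\<^esub> (z, d)"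
          using t zd p True pq by (auto simp: Upper_def lex_sum_def)
        show "(x, s) \<sqsubseteq>\<^bsub>lex_sum L F\<^esub> t"
        proof (cases "x \<sqsubset>\<^bsub>L\<^esub> z")
          case False
          then have "x = z" "a \<sqsubseteq>\<^bsub>F x\<^esub> d" "b \<sqsubseteq>\<^bsub>F x\<^esub> d" using tc by (auto simp: lex_sum_def)
          then have "d \<in> Upper (F x) {a, b}" using tc by (auto simp: Upper_def)
          then have "s \<sqsubseteq>\<^bsub>F x\<^esub> d" by (rule least_le[OF s])
          then show ?thesis using zd \<open>x = z\<close> by (auto simp: lex_sum_def)
        qed (simp add: zd lex_sum_def)
      qed (use p True sc c in \<open>auto simp: lex_sum_def\<close>)
      then show ?thesis by blast
    next
      case False
      have nle: "\<not> x \<sqsubseteq>\<^bsub>L\<^esub> y" "\<not> y \<sqsubseteq>\<^bsub>L\<^esub> x"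
        using incomp p False by (auto simp: lex_sum_def L.lless_eq)
      define j where "j = x \<squnion>\<^bsub>L\<^esub> y"
      have j: "j \<in> carrier L" "x \<sqsubseteq>\<^bsub>L\<^esub> j" "y \<sqsubseteq>\<^bsub>L\<^esub> j"
        using c L.join_left L.join_right by (auto simp: j_def)
      then have lt: "x \<sqsubset>\<^bsub>L\<^esub> j" "y \<sqsubset>\<^bsub>L\<^esub> j" using nle by (auto simp: L.lless_eq)
      obtain e where e: "e \<in> carrier (F j)" "\<forall>d\<in>carrier (F j). e \<sqsubseteq>\<^bsub>F j\<^esub> d"
        using finite_lattice_bottom_top(1)[OF F[OF j(1)]] by blast
      have "least (lex_sum L F) (j, e) (Upper (lex_sum L F) {p, q})"
      proof (rule least_UpperI)
        fix t assume t: "t \<in> Upper (lex_sum L F) {p, q}"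
        obtain z d where zd: "t = (z, d)" by (cases t)
        have tc: "z \<in> carrier L" "d \<in> carrier (F z)" "(x, a) \<sqsubseteq>\<^bsub>lex_sum L F\<^esub> (z, d)" "(y, b) \<sqsubseteq>\<^bsub>lex_sum L F\<^esub> (z, d)"
          using t zd p pq by (auto simp: Upper_def lex_sum_def)
        then have "x \<sqsubseteq>\<^bsub>L\<^esub> z" "y \<sqsubseteq>\<^bsub>L\<^esub> z" using c by (auto simp: lex_sum_def L.lless_eq)
        then have "j \<sqsubseteq>\<^bsub>L\<^esub> z" using L.join_le c tc(1) by (simp add: j_def)
        then show "(j, e) \<sqsubseteq>\<^bsub>lex_sum L F\<^esub> t"
          using zd e tc by (auto simp: lex_sum_def L.lless_eq)
      qed (use p lt c j e in \<open>auto simp: lex_sum_def\<close>)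
      then show ?thesis by blast
    qed
  qed
qed

lemma finite_lattice_dual: "finite_lattice L \<Longrightarrow> finite_lattice (inv_gorder L)"
  using lattice.dual_lattice by (auto simp: finite_lattice_def)

text \<open>Reduces the existence of meets to that of joins.\<close>

lemma lex_sum_dual:
  assumes "lattice L"
  shows "lex_sum (inv_gorder L) (\<lambda>x. inv_gorder (F x)) = inv_gorder (lex_sum L F)"
proof -
  interpret L: lattice L by fact
  show ?thesis by (auto simp: lex_sum_def lless_def L.eq_is_equal fun_eq_iff)
qed

lemma finite_lattice_lex_sum:
  assumes L: "finite_lattice L" and F: "\<And>x. x \<in> carrier L \<Longrightarrow> finite_lattice (F x)"
  shows "finite_lattice (lex_sum L F)"
proof -
  interpret L: lattice L using L by (simp add: finite_lattice_def)
  have po: "partial_order (lex_sum L F)"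
  proof (rule partial_order_lex_sum)
    show "partial_order (F x)" if "x \<in> carrier L" for x
      using F[OF that] by (simp add: finite_lattice_def lattice_def upper_semilattice_def)
  qed (rule L.partial_order_axioms)
  have "upper_semilattice (lex_sum L F)"
    using po lex_sum_join_exists[OF L.lattice_axioms F]
    by (simp add: upper_semilattice_def upper_semilattice_axioms_def)
  moreover have "\<exists>s. greatest (lex_sum L F) s (Lower (lex_sum L F) {p, q})"
    if "p \<in> carrier (lex_sum L F)" "q \<in> carrier (lex_sum L F)" for p q
    using lex_sum_join_exists[OF L.dual_lattice, of "\<lambda>x. inv_gorder (F x)" p q]
      finite_lattice_dual[OF F] that
    by (simp add: lex_sum_dual[OF L.lattice_axioms])
  then have "lower_semilattice (lex_sum L F)"
    using po by (simp add: lower_semilattice_def lower_semilattice_axioms_def)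
  ultimately have "lattice (lex_sum L F)" by (simp add: lattice_def)
  moreover have "finite (carrier (lex_sum L F))" "carrier (lex_sum L F) \<noteq> {}"
    using L F by (auto simp: finite_lattice_def lex_sum_def)
  ultimately show ?thesis by (simp add: finite_lattice_def)
qed

section \<open>From the fibres to the whole sum\<close>

lemma card_antichain_le_width:
  assumes "finite (carrier L)" "antichain L A"
  shows "card A \<le> width L"
proof -
  have "{A. antichain L A} \<subseteq> Pow (carrier L)" by (auto simp: antichain_def)
  then have "finite {A. antichain L A}" using assms(1) finite_subset by blast
  then show ?thesis using assms(2) unfolding width_def by (intro Max_ge) auto
qed

text \<open>Matroids enter only through monotonicity and submodularity of \<open>r\<close> and
  through upper bounds of the same rank as a union. The proof distinguishes whether the indices
  occurring in an up-set have one or two minimal elements.\<close>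

lemma mason_ingleton_lexicographic:
  fixes L :: "'a gorder" and \<pi> :: "'e set \<Rightarrow> 'a" and r :: "'e set \<Rightarrow> int"
    and lo hi :: "'a \<Rightarrow> 'e set"
  assumes L: "lattice L" and antichain: "\<And>A. antichain L A \<Longrightarrow> card A \<le> 2"
    and fin: "finite P" and \<pi>: "\<And>X. X \<in> P \<Longrightarrow> \<pi> X \<in> carrier L"
    and less: "\<And>X Y. X \<in> P \<Longrightarrow> Y \<in> P \<Longrightarrow> \<pi> X \<sqsubset>\<^bsub>L\<^esub> \<pi> Y \<Longrightarrow> X \<subseteq> Y"
    and mono: "\<And>X Y. X \<in> P \<Longrightarrow> Y \<in> P \<Longrightarrow> X \<subseteq> Y \<Longrightarrow> \<pi> X \<sqsubseteq>\<^bsub>L\<^esub> \<pi> Y"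
    and lo: "\<And>x. x \<in> carrier L \<Longrightarrow> lo x \<in> P \<and> \<pi> (lo x) = x"
    and hi: "\<And>x. x \<in> carrier L \<Longrightarrow> hi x \<in> P \<and> \<pi> (hi x) = x"
    and between: "\<And>X. X \<in> P \<Longrightarrow> lo (\<pi> X) \<subseteq> X \<and> X \<subseteq> hi (\<pi> X)"
    and MI: "\<And>x. x \<in> carrier L \<Longrightarrow> mason_ingleton {X\<in>P. \<pi> X = x} r"
    and r_mono: "\<And>X Y. X \<subseteq> Y \<Longrightarrow> r X \<le> r Y"
    and r_submodular: "\<And>X Y. r (X \<union> Y) + r (X \<inter> Y) \<le> r X + r Y"
    and join: "\<And>X Y. X \<in> P \<Longrightarrow> Y \<in> P \<Longrightarrow> \<exists>W\<in>P. X \<subseteq> W \<and> Y \<subseteq> W \<and> r W = r (X \<union> Y)"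
  shows "mason_ingleton P r"
  unfolding mason_ingleton_def
proof (intro allI impI)
  interpret L: lattice L by fact
  fix \<gamma> N U
  assume \<gamma>: "\<forall>X\<in>P. (\<Sum>Y | Y \<in> P \<and> X \<subseteq> Y. \<gamma> Y) = N - r X"
    and U: "up_closed P U" "U \<noteq> {}"
  have UP: "U \<subseteq> P" and up: "\<And>X Y. X \<in> U \<Longrightarrow> Y \<in> P \<Longrightarrow> X \<subseteq> Y \<Longrightarrow> Y \<in> U"
    using U by (auto simp: up_closed_def)
  have finU: "finite U" using UP fin finite_subset by blast
  define fib where "fib x = {X\<in>P. \<pi> X = x}" for x
  have hiU: "hi x \<in> U" if "x \<in> \<pi> ` U" for x
    using that up between hi \<pi> UP by (metis imageE subsetD)
  \<comment> \<open>The inequality for the part of \<open>U\<close> over indices at or above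
    \<open>x\<close>, obtained from the fibre over \<open>x\<close> alone.\<close>
  have cone: "(\<Sum>Y | Y \<in> U \<and> x \<sqsubseteq>\<^bsub>L\<^esub> \<pi> Y. \<gamma> Y) \<le> N - r (\<Inter>(U \<inter> fib x))" if x: "x \<in> \<pi> ` U" for x
  proof -
    have xL: "x \<in> carrier L" using x UP \<pi> by auto
    have hiP: "hi x \<in> P" "\<pi> (hi x) = x" using hi[OF xL] by auto
    have above: "Y \<in> fib x \<or> hi x \<subseteq> Y" if Y: "Y \<in> P" "x \<sqsubseteq>\<^bsub>L\<^esub> \<pi> Y" for Y
      using less[of "hi x" Y] hiP Y by (auto simp: fib_def L.lless_eq)
    \<comment> \<open>Everything above the fibre is collapsed into the weight of its top
      \<open>hi x\<close>. The new weights then satisfy the defining equations within the fibre,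
      with the same \<open>N\<close>.\<close>
    define \<gamma>' where "\<gamma>' Y = (if Y = hi x then \<Sum>W | W \<in> P \<and> hi x \<subseteq> W. \<gamma> W else \<gamma> Y)" for Y
    have collapse: "sum \<gamma>' S = sum \<gamma> (S \<union> {W. W \<in> P \<and> hi x \<subseteq> W})"
      if S: "S \<subseteq> fib x" "hi x \<in> S" for S
    proof -
      have finS: "finite S" using S(1) fin by (auto simp: fib_def intro: finite_subset)
      have "W \<subseteq> hi x" if "W \<in> S" for W
        using that S(1) between[of W] by (auto simp: fib_def)
      then have disj: "(S - {hi x}) \<inter> {W. W \<in> P \<and> hi x \<subseteq> W} = {}" by auto
      have "sum \<gamma>' S = \<gamma>' (hi x) + sum \<gamma>' (S - {hi x})"
        by (rule sum.remove[OF finS S(2)])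
      also have "sum \<gamma>' (S - {hi x}) = sum \<gamma> (S - {hi x})"
        by (rule sum.cong) (auto simp: \<gamma>'_def)
      also have "\<gamma>' (hi x) = (\<Sum>W | W \<in> P \<and> hi x \<subseteq> W. \<gamma> W)" by (simp add: \<gamma>'_def)
      also have "\<dots> + sum \<gamma> (S - {hi x}) = sum \<gamma> ((S - {hi x}) \<union> {W. W \<in> P \<and> hi x \<subseteq> W})"
        using finS fin disj by (subst sum.union_disjoint) auto
      also have "(S - {hi x}) \<union> {W. W \<in> P \<and> hi x \<subseteq> W} = S \<union> {W. W \<in> P \<and> hi x \<subseteq> W}"
        using hiP by auto
      finally show ?thesis .
    qed
    have "\<forall>X\<in>fib x. (\<Sum>Y | Y \<in> fib x \<and> X \<subseteq> Y. \<gamma>' Y) = N - r X"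
    proof
      fix X assume X: "X \<in> fib x"
      have Xt: "X \<subseteq> hi x" "X \<in> P" "\<pi> X = x" using X between[of X] by (auto simp: fib_def)
      have "{Y. Y \<in> fib x \<and> X \<subseteq> Y} \<union> {W. W \<in> P \<and> hi x \<subseteq> W} = {Y. Y \<in> P \<and> X \<subseteq> Y}"
      proof -
        have "Y \<in> fib x \<or> hi x \<subseteq> Y" if "Y \<in> P" "X \<subseteq> Y" for Y
          using above[OF that(1)] mono[OF Xt(2) that] Xt(3) by simp
        then show ?thesis using Xt by (auto simp: fib_def)
      qed
      moreover have "hi x \<in> {Y. Y \<in> fib x \<and> X \<subseteq> Y}" using hiP Xt by (simp add: fib_def)
      ultimately show "(\<Sum>Y | Y \<in> fib x \<and> X \<subseteq> Y. \<gamma>' Y) = N - r X"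
        using collapse[of "{Y. Y \<in> fib x \<and> X \<subseteq> Y}"] \<gamma> Xt by auto
    qed
    moreover have "up_closed (fib x) (U \<inter> fib x)"
      using up UP by (auto simp: up_closed_def fib_def)
    moreover have "hi x \<in> U \<inter> fib x" using hiU[OF x] hiP by (simp add: fib_def)
    ultimately have "sum \<gamma>' (U \<inter> fib x) \<le> N - r (\<Inter>(U \<inter> fib x))"
      using MI[OF xL] unfolding mason_ingleton_def fib_def[symmetric] by blast
    also have "sum \<gamma>' (U \<inter> fib x) = sum \<gamma> (U \<inter> fib x \<union> {W. W \<in> P \<and> hi x \<subseteq> W})"
      using \<open>hi x \<in> U \<inter> fib x\<close> by (intro collapse) auto
    also have "U \<inter> fib x \<union> {W. W \<in> P \<and> hi x \<subseteq> W} = {Y. Y \<in> U \<and> x \<sqsubseteq>\<^bsub>L\<^esub> \<pi> Y}" (is "?l = ?r")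
    proof
      show "?l \<subseteq> ?r"
      proof
        fix W assume "W \<in> ?l"
        then show "W \<in> ?r"
          using hiU[OF x] hiP up mono[of "hi x" W] xL by (auto simp: fib_def)
      qed
      show "?r \<subseteq> ?l" using above UP by auto
    qed
    finally show ?thesis .
  qed
  define M where "M = {x \<in> \<pi> ` U. \<forall>y\<in>\<pi> ` U. y \<sqsubseteq>\<^bsub>L\<^esub> x \<longrightarrow> y = x}"
  have \<pi>U: "\<pi> ` U \<subseteq> carrier L" using UP \<pi> by auto
  have finM: "finite M" using finU by (simp add: M_def)
  \<comment> \<open>This is where the width bound is used: at most two cones cover
    \<open>U\<close>.\<close>
  have "antichain L M" using \<pi>U by (auto simp: antichain_def M_def)
  then have "card M \<le> 2" by (rule antichain)
  have minimal: "\<exists>m\<in>M. m \<sqsubseteq>\<^bsub>L\<^esub> x" if "x \<in> \<pi> ` U" for x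
    using that
  proof (induction "card {y \<in> \<pi> ` U. y \<sqsubset>\<^bsub>L\<^esub> x}" arbitrary: x rule: less_induct)
    case (less x)
    show ?case
    proof (cases "x \<in> M")
      case True
      then show ?thesis using less.prems \<pi>U by blast
    next
      case False
      then obtain y where y: "y \<in> \<pi> ` U" "y \<sqsubset>\<^bsub>L\<^esub> x"
        using less.prems by (auto simp: M_def L.lless_eq)
      have "{z \<in> \<pi> ` U. z \<sqsubset>\<^bsub>L\<^esub> y} \<subset> {z \<in> \<pi> ` U. z \<sqsubset>\<^bsub>L\<^esub> x}"
      proof
        have c: "y \<in> carrier L" "x \<in> carrier L" using y(1) less.prems \<pi>U by auto
        have "z \<sqsubset>\<^bsub>L\<^esub> x" if "z \<in> \<pi> ` U" "z \<sqsubset>\<^bsub>L\<^esub> y" for z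
          using L.lless_trans[OF that(2) y(2) subsetD[OF \<pi>U that(1)] c] .
        then show "{z \<in> \<pi> ` U. z \<sqsubset>\<^bsub>L\<^esub> y} \<subseteq> {z \<in> \<pi> ` U. z \<sqsubset>\<^bsub>L\<^esub> x}" by auto
        have "y \<in> {z \<in> \<pi> ` U. z \<sqsubset>\<^bsub>L\<^esub> x}" "y \<notin> {z \<in> \<pi> ` U. z \<sqsubset>\<^bsub>L\<^esub> y}"
          using y by (auto simp: L.lless_eq)
        then show "{z \<in> \<pi> ` U. z \<sqsubset>\<^bsub>L\<^esub> y} \<noteq> {z \<in> \<pi> ` U. z \<sqsubset>\<^bsub>L\<^esub> x}" by blast
      qed
      then have "card {z \<in> \<pi> ` U. z \<sqsubset>\<^bsub>L\<^esub> y} < card {z \<in> \<pi> ` U. z \<sqsubset>\<^bsub>L\<^esub> x}"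
        using finU by (intro psubset_card_mono) auto
      then obtain m where m: "m \<in> M" "m \<sqsubseteq>\<^bsub>L\<^esub> y" using less.hyps y(1) by blast
      then have "m \<sqsubseteq>\<^bsub>L\<^esub> x"
        using y less.prems \<pi>U L.le_trans[of m y x] by (auto simp: M_def L.lless_eq subset_iff)
      then show ?thesis using m by blast
    qed
  qed
  have "M \<noteq> {}" using U(2) minimal by blast
  then have "card M = 1 \<or> card M = 2"
    using \<open>card M \<le> 2\<close> finM by (metis One_nat_def Suc_1 card_0_eq le_SucE le_zero_eq)
  then show "sum \<gamma> U \<le> N - r (\<Inter>U)"
  proof
    assume "card M = 1"
    then obtain x where x: "M = {x}" by (rule card_1_singletonE)
    then have xU: "x \<in> \<pi> ` U" by (auto simp: M_def)
    have "{Y. Y \<in> U \<and> x \<sqsubseteq>\<^bsub>L\<^esub> \<pi> Y} = U" using minimal x by auto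
    then have "sum \<gamma> U \<le> N - r (\<Inter>(U \<inter> fib x))" using cone[OF xU] by simp
    moreover have "r (\<Inter>U) \<le> r (\<Inter>(U \<inter> fib x))" by (rule r_mono) auto
    ultimately show ?thesis by simp
  next
    assume "card M = 2"
    then obtain x y where xy: "M = {x, y}" "x \<noteq> y" by (auto simp: card_2_iff)
    have xyU: "x \<in> \<pi> ` U" "y \<in> \<pi> ` U" using xy(1) by (auto simp: M_def)
    then have xyL: "x \<in> carrier L" "y \<in> carrier L" using \<pi>U by auto
    have incomp: "\<not> x \<sqsubseteq>\<^bsub>L\<^esub> y" "\<not> y \<sqsubseteq>\<^bsub>L\<^esub> x"
      using \<open>antichain L M\<close> xy by (auto simp: antichain_def)
    let ?Ux = "{Y. Y \<in> U \<and> x \<sqsubseteq>\<^bsub>L\<^esub> \<pi> Y}" and ?Uy = "{Y. Y \<in> U \<and> y \<sqsubseteq>\<^bsub>L\<^esub> \<pi> Y}"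
    define j where "j = x \<squnion>\<^bsub>L\<^esub> y"
    have j: "j \<in> carrier L" "x \<sqsubseteq>\<^bsub>L\<^esub> j" "y \<sqsubseteq>\<^bsub>L\<^esub> j"
      using xyL L.join_left L.join_right by (auto simp: j_def)
    then have lt: "x \<sqsubset>\<^bsub>L\<^esub> j" using incomp by (auto simp: L.lless_eq)
    have loj: "lo j \<in> P" "\<pi> (lo j) = j" using lo[OF j(1)] by auto
    have hi_lo: "hi x \<subseteq> lo j"
      using less[of "hi x" "lo j"] hi[OF xyL(1)] loj lt by auto
    have lo_join: "lo j \<subseteq> Y" if Y: "Y \<in> P" "x \<sqsubseteq>\<^bsub>L\<^esub> \<pi> Y" "y \<sqsubseteq>\<^bsub>L\<^esub> \<pi> Y" for Y
    proof -
      have "j \<sqsubseteq>\<^bsub>L\<^esub> \<pi> Y" using Y xyL \<pi> L.join_le by (simp add: j_def)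
      then show ?thesis
        using between[OF Y(1)] less[OF loj(1) Y(1)] loj(2) by (cases "j = \<pi> Y") (auto simp: L.lless_eq)
    qed
    \<comment> \<open>The overlap of the two cones is a principal up-set, so its weight is known
      exactly. It lies in \<open>U\<close> because \<open>hi x\<close> is in \<open>U\<close> and
      below \<open>lo j\<close>.\<close>
    have "?Ux \<inter> ?Uy = {Y. Y \<in> P \<and> lo j \<subseteq> Y}" (is "?l = ?r")
    proof
      show "?l \<subseteq> ?r"
        using UP lo_join by blast
      show "?r \<subseteq> ?l"
      proof
        fix Y assume "Y \<in> ?r"
        then have Y: "Y \<in> P" "lo j \<subseteq> Y" by auto
        then have "j \<sqsubseteq>\<^bsub>L\<^esub> \<pi> Y" using mono[OF loj(1)] loj(2) by auto
        then have "x \<sqsubseteq>\<^bsub>L\<^esub> \<pi> Y" "y \<sqsubseteq>\<^bsub>L\<^esub> \<pi> Y"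
          using L.le_trans j xyL \<pi>[OF Y(1)] by blast+
        moreover have "Y \<in> U" using up[OF hiU[OF xyU(1)] Y(1)] hi_lo Y by blast
        ultimately show "Y \<in> ?l" by simp
      qed
    qed
    then have "sum \<gamma> (?Ux \<inter> ?Uy) = N - r (lo j)" using \<gamma> loj by simp
    moreover have "sum \<gamma> (?Ux \<union> ?Uy) + sum \<gamma> (?Ux \<inter> ?Uy) = sum \<gamma> ?Ux + sum \<gamma> ?Uy"
      using finU by (intro sum.union_inter) auto
    moreover have "?Ux \<union> ?Uy = U" using minimal xy by auto
    ultimately have "sum \<gamma> U + (N - r (lo j)) = sum \<gamma> ?Ux + sum \<gamma> ?Uy" by simp
    moreover have "sum \<gamma> ?Ux \<le> N - r (\<Inter>(U \<inter> fib x))" "sum \<gamma> ?Uy \<le> N - r (\<Inter>(U \<inter> fib y))"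
      using cone xyU by auto
    \<comment> \<open>A member \<open>W\<close> of \<open>P\<close> above both \<open>lo x\<close>
      and \<open>lo y\<close> has index above \<open>j\<close> and so contains \<open>lo j\<close>.
      Taking \<open>W\<close> of the same rank as \<open>lo x \<union> lo y\<close> suffices, as
      \<open>lo x\<close> and \<open>lo y\<close> lie in the two intersections.\<close>
    moreover have "r (lo j) \<le> r (\<Inter>(U \<inter> fib x) \<union> \<Inter>(U \<inter> fib y))"
    proof -
      have lo_xy: "lo x \<in> P" "lo y \<in> P" "\<pi> (lo x) = x" "\<pi> (lo y) = y"
        using lo xyL by auto
      obtain W where W: "W \<in> P" "lo x \<subseteq> W" "lo y \<subseteq> W" "r W = r (lo x \<union> lo y)"
        using join[OF lo_xy(1,2)] by blast
      have "lo j \<subseteq> W"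
        using mono[of "lo x" W] mono[of "lo y" W] W lo_xy by (intro lo_join) auto
      then have "r (lo j) \<le> r (lo x \<union> lo y)" using r_mono W(4) by metis
      also have "\<dots> \<le> r (\<Inter>(U \<inter> fib x) \<union> \<Inter>(U \<inter> fib y))"
        using between by (intro r_mono) (fastforce simp: fib_def)
      finally show ?thesis .
    qed
    moreover have "r (\<Inter>U) \<le> r (\<Inter>(U \<inter> fib x) \<inter> \<Inter>(U \<inter> fib y))" by (rule r_mono) auto
    \<comment> \<open>Adding the cone bounds and subtracting the overlap leaves one
      \<open>N\<close>; submodularity trades the ranks of the two intersections for those of their
      union and of their common part, and the former is at least \<open>r (lo j)\<close>.\<close>
    ultimately show ?thesis
      using r_submodular[of "\<Inter>(U \<inter> fib x)" "\<Inter>(U \<inter> fib y)"] by linarith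
  qed
qed

theorem theorem5p5:
  fixes L :: "'a gorder" and F :: "'a \<Rightarrow> 'b gorder"
  assumes "finite_lattice L"
    and "width L \<le> 2"
    and "\<And>x. x \<in> carrier L \<Longrightarrow> Tr_lattice (F x)"
  shows "Tr_lattice (lex_sum L F)"
  unfolding Tr_lattice_def
proof (intro conjI allI impI)
  have flF: "finite_lattice (F x)" if "x \<in> carrier L" for x
    using assms(3)[OF that] by (simp add: Tr_lattice_def)
  show "finite_lattice (lex_sum L F)"
    using assms(1) flF by (rule finite_lattice_lex_sum)
  interpret L: lattice L using assms(1) by (simp add: finite_lattice_def)
  fix E :: "nat set" and I
  assume M: "matroid E I" and iso: "order_isomorphic (cyclic_flats E I) (lex_sum L F)"
  interpret matroid E I by (rule M)
  define P where "P = {X. cyclic_flat E I X}"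
  obtain h where h: "bij_betw h P (carrier (lex_sum L F))"
      "\<forall>X\<in>P. \<forall>Y\<in>P. X \<subseteq> Y \<longleftrightarrow> h X \<sqsubseteq>\<^bsub>lex_sum L F\<^esub> h Y"
    using iso by (auto simp: order_isomorphic_def cyclic_flats_def P_def)
  have le: "X \<subseteq> Y \<longleftrightarrow> fst (h X) \<sqsubset>\<^bsub>L\<^esub> fst (h Y) \<or>
      (fst (h X) = fst (h Y) \<and> snd (h X) \<sqsubseteq>\<^bsub>F (fst (h X))\<^esub> snd (h Y))" if "X \<in> P" "Y \<in> P" for X Y
    using h(2) that by (simp add: lex_sum_def split_beta)
  have mem: "fst (h X) \<in> carrier L" "snd (h X) \<in> carrier (F (fst (h X)))" if "X \<in> P" for X
    using bij_betwE[OF h(1)] that by (force simp: lex_sum_def)+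
  have surj: "\<exists>X\<in>P. h X = (x, a)" if "x \<in> carrier L" "a \<in> carrier (F x)" for x a
  proof -
    have "(x, a) \<in> h ` P" using h(1) that by (simp add: bij_betw_def lex_sum_def)
    then show ?thesis by force
  qed
  have "\<exists>B. B \<in> P \<and> fst (h B) = x \<and> (\<forall>X\<in>P. fst (h X) = x \<longrightarrow> B \<subseteq> X)" if x: "x \<in> carrier L" for x
  proof -
    obtain b where b: "b \<in> carrier (F x)" "\<forall>a\<in>carrier (F x). b \<sqsubseteq>\<^bsub>F x\<^esub> a"
      using finite_lattice_bottom_top(1)[OF flF[OF x]] by blast
    obtain B where "B \<in> P" "h B = (x, b)" using surj x b(1) by blast
    then show ?thesis using b(2) mem le by (intro exI[of _ B]) auto
  qed
  \<comment> \<open>The cyclic flats \<open>lo x\<close> and, below, \<open>hi x\<close> correspond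
    to the bottom and top of the fibre over \<open>x\<close>.\<close>
  then obtain lo where lo: "\<And>x. x \<in> carrier L \<Longrightarrow>
      lo x \<in> P \<and> fst (h (lo x)) = x \<and> (\<forall>X\<in>P. fst (h X) = x \<longrightarrow> lo x \<subseteq> X)"
    by metis
  have "\<exists>T. T \<in> P \<and> fst (h T) = x \<and> (\<forall>X\<in>P. fst (h X) = x \<longrightarrow> X \<subseteq> T)" if x: "x \<in> carrier L" for x
  proof -
    obtain t where t: "t \<in> carrier (F x)" "\<forall>a\<in>carrier (F x). a \<sqsubseteq>\<^bsub>F x\<^esub> t"
      using finite_lattice_bottom_top(2)[OF flF[OF x]] by blast
    obtain T where "T \<in> P" "h T = (x, t)" using surj x t(1) by blast
    then show ?thesis using t(2) mem le by (intro exI[of _ T]) auto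
  qed
  then obtain hi where hi: "\<And>x. x \<in> carrier L \<Longrightarrow>
      hi x \<in> P \<and> fst (h (hi x)) = x \<and> (\<forall>X\<in>P. fst (h X) = x \<longrightarrow> X \<subseteq> hi x)"
    by metis
  have MI: "mason_ingleton {X\<in>P. fst (h X) = x} (\<lambda>X. int (rank I X))" if x: "x \<in> carrier L" for x
  proof -
    have bt: "cyclic_flat E I (lo x)" "cyclic_flat E I (hi x)" "lo x \<subseteq> hi x"
      using lo[OF x] hi[OF x] by (auto simp: P_def)
    \<comment> \<open>A flat between \<open>lo x\<close> and \<open>hi x\<close> has its index
      squeezed between \<open>x\<close> and \<open>x\<close>, so the fibre is a full interval of
      cyclic flats and hence comes from a minor.\<close>
    have fib: "{X. cyclic_flat E I X \<and> lo x \<subseteq> X \<and> X \<subseteq> hi x} = {X\<in>P. fst (h X) = x}" (is "?l = ?r")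
    proof
      show "?r \<subseteq> ?l" using lo[OF x] hi[OF x] by (auto simp: P_def)
      show "?l \<subseteq> ?r"
      proof
        fix X assume "X \<in> ?l"
        then have X: "X \<in> P" "lo x \<subseteq> X" "X \<subseteq> hi x" by (auto simp: P_def)
        then have "x \<sqsubseteq>\<^bsub>L\<^esub> fst (h X)" "fst (h X) \<sqsubseteq>\<^bsub>L\<^esub> x"
          using le[of "lo x" X] le[of X "hi x"] lo[OF x] hi[OF x] x mem[OF X(1)]
          by (auto simp: L.lless_eq)
        then show "X \<in> ?r" using X(1) x mem(1)[OF X(1)] L.le_antisym by auto
      qed
    qed
    have topE: "hi x \<subseteq> E" using bt(2) by (simp add: cyclic_flat_def flat_def)
    have car: "{X. cyclic_flat (hi x) (minor_indep (lo x) (hi x)) X} = {X\<in>P. fst (h X) = x}"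
      using cyclic_flat_minor_iff[OF bt(3) topE] bt(1,2) fib by (simp add: cyclic_flat_iff)
    have "bij_betw (snd \<circ> h) {X\<in>P. fst (h X) = x} (carrier (F x))"
      unfolding bij_betw_def
    proof
      show "inj_on (snd \<circ> h) {X\<in>P. fst (h X) = x}"
        using h(1) by (auto simp: bij_betw_def inj_on_def prod_eq_iff)
      show "(snd \<circ> h) ` {X\<in>P. fst (h X) = x} = carrier (F x)"
        using surj[OF x] mem by force
    qed
    then have "order_isomorphic (cyclic_flats (hi x) (minor_indep (lo x) (hi x))) (F x)"
      unfolding order_isomorphic_def cyclic_flats_def using le
      by (intro exI[of _ "snd \<circ> h"]) (auto simp: car L.lless_eq)
    then have "transversal (hi x) (minor_indep (lo x) (hi x))"
      using Tr_latticeD[OF assms(3)[OF x] matroid_minor[OF bt(3) topE]] by blast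
    then show ?thesis using mason_ingleton_interval[OF bt] fib by simp
  qed
  have "mason_ingleton P (\<lambda>X. int (rank I X))"
  proof (rule mason_ingleton_lexicographic[where L = L and \<pi> = "fst \<circ> h" and lo = lo and hi = hi])
    show "lattice L" by (rule L.lattice_axioms)
    show "card A \<le> 2" if "antichain L A" for A
      using card_antichain_le_width[OF _ that] assms(1,2) by (simp add: finite_lattice_def)
    show "finite P" unfolding P_def by (rule finite_cyclic_flats)
    show "(fst \<circ> h) X \<in> carrier L" if "X \<in> P" for X using mem that by simp
    show "X \<subseteq> Y" if "X \<in> P" "Y \<in> P" "(fst \<circ> h) X \<sqsubset>\<^bsub>L\<^esub> (fst \<circ> h) Y" for X Y
      using that le by simp
    show "(fst \<circ> h) X \<sqsubseteq>\<^bsub>L\<^esub> (fst \<circ> h) Y" if "X \<in> P" "Y \<in> P" "X \<subseteq> Y" for X Y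
      using that le mem by (auto simp: L.lless_eq)
    show "lo x \<in> P \<and> (fst \<circ> h) (lo x) = x" if "x \<in> carrier L" for x using lo[OF that] by simp
    show "hi x \<in> P \<and> (fst \<circ> h) (hi x) = x" if "x \<in> carrier L" for x using hi[OF that] by simp
    show "lo ((fst \<circ> h) X) \<subseteq> X \<and> X \<subseteq> hi ((fst \<circ> h) X)" if "X \<in> P" for X
      using lo hi mem(1)[OF that] that by simp
    show "mason_ingleton {X \<in> P. (fst \<circ> h) X = x} (\<lambda>X. int (rank I X))" if "x \<in> carrier L" for x
      using MI[OF that] by simp
    show "int (rank I X) \<le> int (rank I Y)" if "X \<subseteq> Y" for X Y
      using rank_mono[OF that] by simp
    show "int (rank I (X \<union> Y)) + int (rank I (X \<inter> Y)) \<le> int (rank I X) + int (rank I Y)" for X Y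
      using rank_submodular[of X Y] by linarith
    show "\<exists>W\<in>P. X \<subseteq> W \<and> Y \<subseteq> W \<and> int (rank I W) = int (rank I (X \<union> Y))"
      if "X \<in> P" "Y \<in> P" for X Y
    proof -
      \<comment> \<open>The join of two cyclic flats is the closure of their union, which is cyclic
        and has the rank of the union.\<close>
      have XY: "X \<union> Y \<subseteq> E" "cyclic (X \<union> Y)"
        using that cyclic_Union[of "{X, Y}"] by (auto simp: P_def cyclic_flat_iff flat_def)
      then show ?thesis
        using cyclic_flat_closure[OF XY] subset_closure[OF XY(1)] rank_closure[OF XY(1)]
        by (intro bexI[of _ "closure (X \<union> Y)"]) (auto simp: P_def)
    qed
  qed
  then show "transversal E I"
    by (simp add: transversal_iff_mason_ingleton P_def)
qed

end
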